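(* Let $\Omega$ be a set, $q$ a set of operations on $\Omega$ and $\Pi$ a set of similarities on $\Omega$. Then: (1) For every quantifier $Q$ on $\Omega$: $Q\in\mathrm{Inv}(\mathrm{Sim}(q))$ if and only if $Q^{\upharpoonright q}$ is definable in $\mathscr L^-_{\infty\infty}(q)$. For every finitary relation $R$ on $\Omega$: $R\in\mathrm{Inv}(\mathrm{Sim}(q))$ if and only if $R$ is definable in $\mathscr L^-_{\infty\infty}(q)$. (2) $\mathrm{Sim}(\mathrm{Inv}(\Pi))$ is the smallest full monoid of similarities including $\Pi$.
   Context: A similarity on $\Omega$ is a relation $\pi\subseteq\Omega\times\Omega$ such that every $a\in\Omega$ has some $b$ with $a\pi b$, and every $b\in\Omega$ has some $a$ with $a\pi b$. For tuples $\bar a=(a_i)_{i<\alpha}$, $\bar b=(b_i)_{i<\alpha}$, $\bar a\,\pi\,\bar b$ means $a_i\pi b_i$ for all $i$. For $R,S\subseteq\Omega^k$, $R\,\pi\,S$ means: for all $\bar a,\bar b\in\Omega^k$ with $\bar a\pi\bar b$, $\bar a\in R$ iff $\bar b\in S$; for sequences, $\bar R\,\pi\,\bar S$ means $R_i\,\pi\,S_i$ for each $i$. A quantifier on $\Omega$ is a subset of $\mathcal P(\Omega^{k_1})\times\cdots\times\mathcal P(\Omega^{k_l})$ ($l,k_i$ finite); a set of operations is a set of finitary relations and quantifiers on $\Omega$. $\mathscr L^-_{\infty\infty}(q)$ is the equality-free infinitary logic (arbitrary conjunctions/disjunctions, quantification over arbitrary sequences of variables) with a predicate symbol for each relation in $q$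 and a generalized (Lindström) quantifier symbol for each quantifier in $q$, interpreted in $\Omega$: $Q\bar x_1\dots\bar x_l(\phi_1,\dots,\phi_l)$ holds iff the tuple of sets of $k_i$-tuples satisfying $\phi_i$ lies in $Q$. Define $a\sim_q b$ iff for every formula $\phi(x,\bar y)$ of $\mathscr L^-_{\infty\infty}(q)$ and every tuple $\bar c$ from $\Omega$, $\Omega,q\models\phi(a,\bar c)\iff\Omega,q\models\phi(b,\bar c)$. For a set $\Pi$ of similarities, $a\approx_\Pi b$ iff for every finite $k$ and every $\bar c\in\Omega^k$ there is $\pi\in\Pi$ with $(a,\bar c)\,\pi\,(b,\bar c)$. A relation $R\subseteq\Omega^k$ is invariant under $\pi$ (or under an equivalence relation $\sim$, viewed as a similarity) if $\bar a\pi\bar b$ implies ($\bar a\in R\iff\bar b\in R$). Given an equivalence relation $\sim$, a quantifier $Q$ is $\sim$-invariant under $\pi$ if for all $\bar R,\bar S$ of the type of $Q$ with every $R_i,S_i$ invariant under $\sim$ and $\bar R\,\pi\,\bar S$: $\bar R\in Q\iff\bar S\in Q$. $\mathrm{Inv}(\Pi)$ is the set of all relations invariant under every $\pi\in\Pi$ and all quantifiers that are $\approx_\Pi$-invariant under every $\pi\in\Pi$. $\mathrm{Sim}(q)$ is the set of similarities $\pi$ such that every relation in $q$ is invariant under $\pi$ and every quantifier in $q$ is $\sim_q$-invariant under $\pi$. For a quantifier $Q$, $Q^{\upharpoonright q}$ is the set of $(R_1,\dots,R_l)\in Q$ such that each $R_i$ is definable in $\mathscr L^-_{\infty\infty}(q)$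 with parameters from $\Omega$. A relation $R\subseteq\Omega^k$ is definable in $\mathscr L^-_{\infty\infty}(q)$ if some formula $\phi(x_1,\dots,x_k)$ defines it in $(\Omega,q)$; a set $Q'$ of tuples of relations of type $(k_1,\dots,k_l)$ is definable if there is a sentence $\phi(\bar R_1,\dots,\bar R_l)$ of $\mathscr L^-_{\infty\infty}(q)$ expanded with new predicate symbols of arities $k_i$ with $(\Omega,q,R_1,\dots,R_l)\models\phi$ iff $(R_1,\dots,R_l)\in Q'$. A set $\Pi$ of similarities is a monoid with involution if it is closed under relational composition and converses; it is full if moreover $\approx_\Pi\in\Pi$ and $\Pi$ is closed under subsimilarities (if $\pi\in\Pi$ and $\pi'\subseteq\pi$ is a similarity then $\pi'\in\Pi$). *)

theory Defs
  imports Main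
begin

text \<open>The universe Omega is the type 'a (Omega = UNIV). Variables of the
infinitary logic range over a type 'v. Tuples are lists; a k-ary relation is a
set of lists of length k.\<close>

datatype 'a oper = Rel nat "'a list set" | Quant "nat list" "'a list set list set"

definition tuples :: "nat \<Rightarrow> 'a list set" where
  "tuples k = {xs. length xs = k}"

definition rels_of_type :: "nat list \<Rightarrow> 'a list set list set" where
  "rels_of_type ks = {Rs. length Rs = length ks \<and> (\<forall>i<length ks. Rs ! i \<subseteq> tuples (ks ! i))}"

definition wf_oper :: "'a oper \<Rightarrow> bool" where
  "wf_oper op = (case op of Rel k R \<Rightarrow> R \<subseteq> tuples k | Quant ks Q \<Rightarrow> Q \<subseteq> rels_of_type ks)"

definition upds :: "('v \<Rightarrow> 'a) \<Rightarrow> 'v list \<Rightarrow> 'a list \<Rightarrow> 'v \<Rightarrow> 'a" where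
  "upds s vs as = fold (\<lambda>(v, a) t. t(v := a)) (zip vs as) s"

text \<open>Relation defined by the set of satisfying assignments S in variables vs,
with remaining variables (parameters) given by s.\<close>
definition rel_of :: "('v \<Rightarrow> 'a) set \<Rightarrow> ('v \<Rightarrow> 'a) \<Rightarrow> 'v list \<Rightarrow> 'a list set" where
  "rel_of S s vs = {as. length as = length vs \<and> upds s vs as \<in> S}"

text \<open>Semantic rendering of formulas of the equality-free infinitary logic over q,
expanded by new predicate symbols of arities ks: a formula is identified with the
map sending an interpretation P of the new symbols to its set of satisfying
assignments.\<close>
inductive_set fmlx :: "'a oper set \<Rightarrow> nat list \<Rightarrow> ('a list set list \<Rightarrow> ('v \<Rightarrow> 'a) set) set"
  for q :: "'a oper set" and ks :: "nat list" where
  atom: "Rel k R \<in> q \<Longrightarrow> length ys = k \<Longrightarrow> (\<lambda>P. {s. map s ys \<in> R}) \<in> fmlx q ks"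
| newatom: "i < length ks \<Longrightarrow> length ys = ks ! i \<Longrightarrow> (\<lambda>P. {s. map s ys \<in> P ! i}) \<in> fmlx q ks"
| neg: "f \<in> fmlx q ks \<Longrightarrow> (\<lambda>P. - f P) \<in> fmlx q ks"
| conj: "(\<forall>f\<in>F. f \<in> fmlx q ks) \<Longrightarrow> (\<lambda>P. \<Inter>f\<in>F. f P) \<in> fmlx q ks"
| ex: "f \<in> fmlx q ks \<Longrightarrow> (\<lambda>P. {s. \<exists>t. (\<forall>v. v \<notin> W \<longrightarrow> t v = s v) \<and> t \<in> f P}) \<in> fmlx q ks"
| quant: "Quant ls Q \<in> q \<Longrightarrow> length xss = length ls \<Longrightarrow>
     (\<forall>i<length ls. distinct (xss ! i) \<and> length (xss ! i) = ls ! i) \<Longrightarrow>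
     length fs = length ls \<Longrightarrow> (\<forall>f\<in>set fs. f \<in> fmlx q ks) \<Longrightarrow>
     (\<lambda>P. {s. map (\<lambda>i. rel_of ((fs ! i) P) s (xss ! i)) [0..<length ls] \<in> Q}) \<in> fmlx q ks"

definition fml :: "'a oper set \<Rightarrow> ('v \<Rightarrow> 'a) set set" where
  "fml q = (\<lambda>f. f []) ` fmlx q []"

definition depends_only :: "('v \<Rightarrow> 'a) set \<Rightarrow> 'v set \<Rightarrow> bool" where
  "depends_only S V = (\<forall>s t. (\<forall>v\<in>V. s v = t v) \<longrightarrow> (s \<in> S \<longleftrightarrow> t \<in> S))"

definition definable_rel :: "'v itself \<Rightarrow> 'a oper set \<Rightarrow> nat \<Rightarrow> 'a list set \<Rightarrow> bool" where
  "definable_rel _ q k R = (\<exists>S\<in>(fml q :: ('v \<Rightarrow> 'a) set set). \<exists>vs. distinct vs \<and> length vs = k \<and>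
      depends_only S (set vs) \<and> (\<forall>s. R = rel_of S s vs))"

definition definable_rel_param :: "'v itself \<Rightarrow> 'a oper set \<Rightarrow> nat \<Rightarrow> 'a list set \<Rightarrow> bool" where
  "definable_rel_param _ q k R = (\<exists>S\<in>(fml q :: ('v \<Rightarrow> 'a) set set). \<exists>vs s. distinct vs \<and> length vs = k \<and>
      R = rel_of S s vs)"

definition definable_quant :: "'v itself \<Rightarrow> 'a oper set \<Rightarrow> nat list \<Rightarrow> 'a list set list set \<Rightarrow> bool" where
  "definable_quant _ q ks Q' = (\<exists>f\<in>(fmlx q ks :: ('a list set list \<Rightarrow> ('v \<Rightarrow> 'a) set) set).
      \<forall>Rs\<in>rels_of_type ks. (f Rs = {} \<or> f Rs = UNIV) \<and> (Rs \<in> Q' \<longleftrightarrow> f Rs = UNIV))"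

definition simeq :: "'v itself \<Rightarrow> 'a oper set \<Rightarrow> ('a \<times> 'a) set" where
  "simeq _ q = {(a, b). \<forall>S\<in>(fml q :: ('v \<Rightarrow> 'a) set set). \<forall>x s. s(x := a) \<in> S \<longleftrightarrow> s(x := b) \<in> S}"

definition similarity :: "('a \<times> 'a) set \<Rightarrow> bool" where
  "similarity \<pi> = (Domain \<pi> = UNIV \<and> Range \<pi> = UNIV)"

definition tup_rel :: "('a \<times> 'a) set \<Rightarrow> 'a list \<Rightarrow> 'a list \<Rightarrow> bool" where
  "tup_rel \<pi> as bs = list_all2 (\<lambda>a b. (a, b) \<in> \<pi>) as bs"

definition sim_rel :: "('a \<times> 'a) set \<Rightarrow> nat \<Rightarrow> 'a list set \<Rightarrow> 'a list set \<Rightarrow> bool" where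
  "sim_rel \<pi> k R S = (\<forall>as bs. length as = k \<longrightarrow> tup_rel \<pi> as bs \<longrightarrow> (as \<in> R \<longleftrightarrow> bs \<in> S))"

definition rel_inv :: "('a \<times> 'a) set \<Rightarrow> nat \<Rightarrow> 'a list set \<Rightarrow> bool" where
  "rel_inv \<pi> k R = sim_rel \<pi> k R R"

definition quant_inv :: "('a \<times> 'a) set \<Rightarrow> ('a \<times> 'a) set \<Rightarrow> nat list \<Rightarrow> 'a list set list set \<Rightarrow> bool" where
  "quant_inv E \<pi> ks Q = (\<forall>Rs\<in>rels_of_type ks. \<forall>Ss\<in>rels_of_type ks.
      (\<forall>i<length ks. rel_inv E (ks ! i) (Rs ! i) \<and> rel_inv E (ks ! i) (Ss ! i) \<and>
                    sim_rel \<pi> (ks ! i) (Rs ! i) (Ss ! i)) \<longrightarrow> (Rs \<in> Q \<longleftrightarrow> Ss \<in> Q))"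

definition approx :: "('a \<times> 'a) set set \<Rightarrow> ('a \<times> 'a) set" where
  "approx \<Pi> = {(a, b). \<forall>cs. \<exists>\<pi>\<in>\<Pi>. tup_rel \<pi> (a # cs) (b # cs)}"

definition Inv :: "('a \<times> 'a) set set \<Rightarrow> 'a oper set" where
  "Inv \<Pi> = {Rel k R | k R. R \<subseteq> tuples k \<and> (\<forall>\<pi>\<in>\<Pi>. rel_inv \<pi> k R)}
         \<union> {Quant ks Q | ks Q. Q \<subseteq> rels_of_type ks \<and> (\<forall>\<pi>\<in>\<Pi>. quant_inv (approx \<Pi>) \<pi> ks Q)}"

definition Sim :: "'v itself \<Rightarrow> 'a oper set \<Rightarrow> ('a \<times> 'a) set set" where
  "Sim vt q = {\<pi>. similarity \<pi> \<and> (\<forall>op\<in>q. case op of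
       Rel k R \<Rightarrow> rel_inv \<pi> k R
     | Quant ks Q \<Rightarrow> quant_inv (simeq vt q) \<pi> ks Q)}"

definition restrict_quant :: "'v itself \<Rightarrow> 'a oper set \<Rightarrow> nat list \<Rightarrow> 'a list set list set \<Rightarrow> 'a list set list set" where
  "restrict_quant vt q ks Q = {Rs\<in>Q. \<forall>i<length ks. definable_rel_param vt q (ks ! i) (Rs ! i)}"

definition monoid_inv :: "('a \<times> 'a) set set \<Rightarrow> bool" where
  "monoid_inv \<Pi> = ((\<forall>\<pi>\<in>\<Pi>. \<forall>\<rho>\<in>\<Pi>. \<pi> O \<rho> \<in> \<Pi>) \<and> (\<forall>\<pi>\<in>\<Pi>. \<pi>\<inverse> \<in> \<Pi>))"

definition full_monoid :: "('a \<times> 'a) set set \<Rightarrow> bool" where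
  "full_monoid \<Pi> = (monoid_inv \<Pi> \<and> approx \<Pi> \<in> \<Pi> \<and>
      (\<forall>\<pi>\<in>\<Pi>. \<forall>\<pi>'. \<pi>' \<subseteq> \<pi> \<and> similarity \<pi>' \<longrightarrow> \<pi>' \<in> \<Pi>))"

end

(* Indistinguishability E = simeq q is itself definable by an infinitary formula, so it is
preserved by every similarity in Sim q, and all formulas are preserved by Sim q. Conversely, with
one variable for each element of Omega an assignment encodes a similarity up to E, and the
condition that this similarity lies in Sim q is a formula; an invariant relation or quantifier is
then defined as the union of the images of its members under all encoded similarities.
For (2), formulas over Inv Pi cannot separate approx-equivalent elements, since only the invariance
of the relation symbols matters for that; hence Pi is included in Sim (Inv Pi). Minimality comes
from the quantifier of all Sigma-images of a well-order of the classes of approx Sigma. *)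

theory Submission
  imports Defs
begin

text \<open>A member of \<open>Sim q\<close> respects a quantifier only on
  \<open>simeq\<close>-invariant relations, so the induction showing that it respects formulas must
  already know that subformulas define such relations. A separate induction,
  \<open>fmlx_rel_inv\<close>, supplies this without mentioning \<open>Sim\<close>, which avoids a
  circle. Since the logic has no equality, elements can be named only up to \<open>simeq\<close>;
  hence the work modulo a congruence \<open>E\<close> and the notion \<open>compatible\<close>. The
  variables come in two disjoint supplies: \<open>y b\<close> holds a chosen image of
  \<open>b\<close>, and the \<open>z n\<close> hold the arguments of a relation. Changing arguments
  therefore leaves the encoded similarity alone. A well-order serves in (2) because it is rigid: two
  similarities with the same image of it agree up to \<open>E\<close>, and fullness absorbs this
  difference by composing with \<open>approx \<Sigma>\<close> and passing to a
  subsimilarity.\<close>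

section \<open>Tuples, similarities and invariant relations\<close>

lemma tup_rel_simps [simp]:
  "tup_rel \<pi> [] bs \<longleftrightarrow> bs = []"
  "tup_rel \<pi> as [] \<longleftrightarrow> as = []"
  "tup_rel \<pi> (a # as) (b # bs) \<longleftrightarrow> (a, b) \<in> \<pi> \<and> tup_rel \<pi> as bs"
  by (auto simp: tup_rel_def)

lemma tup_rel_length: "tup_rel \<pi> as bs \<Longrightarrow> length as = length bs"
  by (auto simp: tup_rel_def dest: list_all2_lengthD)

lemma tup_rel_iff_nth:
  "tup_rel \<pi> as bs \<longleftrightarrow> length as = length bs \<and> (\<forall>i<length as. (as ! i, bs ! i) \<in> \<pi>)"
  by (auto simp: tup_rel_def list_all2_conv_all_nth)

lemma tup_rel_mono: "tup_rel \<pi> as bs \<Longrightarrow> \<pi> \<subseteq> \<rho> \<Longrightarrow> tup_rel \<rho> as bs"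
  by (auto simp: tup_rel_iff_nth)

lemma tup_rel_converse: "tup_rel (\<pi>\<inverse>) as bs \<longleftrightarrow> tup_rel \<pi> bs as"
  by (auto simp: tup_rel_iff_nth)

lemma tup_rel_refl: "(\<And>a. (a, a) \<in> \<pi>) \<Longrightarrow> tup_rel \<pi> as as"
  by (auto simp: tup_rel_iff_nth)

lemma tup_rel_relcomp: "tup_rel (\<pi> O \<rho>) as cs \<longleftrightarrow> (\<exists>bs. tup_rel \<pi> as bs \<and> tup_rel \<rho> bs cs)"
proof
  assume "tup_rel (\<pi> O \<rho>) as cs"
  then have l: "length as = length cs"
    and "\<forall>i. \<exists>b. i < length as \<longrightarrow> (as ! i, b) \<in> \<pi> \<and> (b, cs ! i) \<in> \<rho>"
    by (auto simp: tup_rel_iff_nth)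
  then obtain g where "\<forall>i. i < length as \<longrightarrow> (as ! i, g i) \<in> \<pi> \<and> (g i, cs ! i) \<in> \<rho>"
    by metis
  then have "tup_rel \<pi> as (map g [0..<length as]) \<and> tup_rel \<rho> (map g [0..<length as]) cs"
    using l by (auto simp: tup_rel_iff_nth)
  then show "\<exists>bs. tup_rel \<pi> as bs \<and> tup_rel \<rho> bs cs" by blast
qed (auto simp: tup_rel_iff_nth)

lemma similarity_right: "similarity \<pi> \<Longrightarrow> \<exists>b. (a, b) \<in> \<pi>"
  unfolding similarity_def by blast

lemma similarity_left: "similarity \<pi> \<Longrightarrow> \<exists>a. (a, b) \<in> \<pi>"
  unfolding similarity_def by blast

lemma similarity_converse: "similarity \<pi> \<Longrightarrow> similarity (\<pi>\<inverse>)"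
  by (auto simp: similarity_def)

lemma similarity_relcomp: "similarity \<pi> \<Longrightarrow> similarity \<rho> \<Longrightarrow> similarity (\<pi> O \<rho>)"
  unfolding similarity_def by blast

lemma similarity_tup_left:
  assumes "similarity \<pi>" obtains as where "tup_rel \<pi> as bs"
proof -
  obtain g where "\<And>b. (g b, b) \<in> \<pi>"
    using similarity_left[OF assms] choice[of "\<lambda>b a. (a, b) \<in> \<pi>"] by blast
  then have "tup_rel \<pi> (map g bs) bs" by (auto simp: tup_rel_iff_nth)
  then show thesis by (rule that)
qed

lemma sim_relD: "sim_rel \<pi> k R S \<Longrightarrow> length as = k \<Longrightarrow> tup_rel \<pi> as bs \<Longrightarrow> as \<in> R \<longleftrightarrow> bs \<in> S"
  by (auto simp: sim_rel_def)

lemma rel_invD: "rel_inv E k R \<Longrightarrow> length as = k \<Longrightarrow> tup_rel E as bs \<Longrightarrow> as \<in> R \<longleftrightarrow> bs \<in> R"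
  by (auto simp: rel_inv_def sim_rel_def)

lemma rel_inv_antimono: "E \<subseteq> E' \<Longrightarrow> rel_inv E' k R \<Longrightarrow> rel_inv E k R"
  unfolding rel_inv_def sim_rel_def using tup_rel_mono by blast

lemma sim_rel_converse: "sim_rel (\<pi>\<inverse>) k R S \<longleftrightarrow> sim_rel \<pi> k S R"
  unfolding sim_rel_def tup_rel_converse by (metis tup_rel_length)

lemma sim_rel_relcompI: "sim_rel \<pi> k R S \<Longrightarrow> sim_rel \<rho> k S T \<Longrightarrow> sim_rel (\<pi> O \<rho>) k R T"
  unfolding sim_rel_def tup_rel_relcomp by (metis tup_rel_length)

text \<open>Entries are exchanged from left to right. Both \<open>simeq\<close> and
  \<open>approx\<close> are defined by replacing a single element, so for them only the one-place
  step is directly available.\<close>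

lemma rel_inv_coordinatewise:
  fixes R :: "'a list set"
  assumes step: "\<And>a b (as :: 'a list) bs. (a, b) \<in> E \<Longrightarrow> length as + length bs + 1 = k \<Longrightarrow>
      as @ a # bs \<in> R \<longleftrightarrow> as @ b # bs \<in> R"
  shows "rel_inv E k R"
proof -
  \<comment> \<open>\<open>pre\<close> is the part of the tuple whose entries have already been
    replaced.\<close>
  have "pre @ as \<in> R \<longleftrightarrow> pre @ bs \<in> R"
    if "tup_rel E as bs" "length pre + length as = k" for pre as bs
    using that unfolding tup_rel_def
  proof (induction arbitrary: pre rule: list_all2_induct)
    case (Cons a as b bs)
    have "pre @ a # as \<in> R \<longleftrightarrow> (pre @ [b]) @ as \<in> R"
      using step[of a b pre as] Cons by auto
    also have "\<dots> \<longleftrightarrow> (pre @ [b]) @ bs \<in> R" using Cons by (intro Cons.IH) auto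
    finally show ?case by simp
  qed simp
  from this[of _ _ "[]"] show ?thesis by (auto simp: rel_inv_def sim_rel_def)
qed

section \<open>Similarities compatible with a relation\<close>

text \<open>For reflexive \<open>E\<close> this forces any two images of one point, and any two
  preimages, to be \<open>E\<close>-related; for an equivalence \<open>E\<close>, a compatible
  similarity acts as a permutation of the classes. It is also applied to a well-founded relation in
  place of \<open>E\<close>.\<close>

definition compatible :: "('a \<times> 'a) set \<Rightarrow> ('a \<times> 'a) set \<Rightarrow> bool" where
  "compatible E \<pi> \<longleftrightarrow> (\<forall>a a' b b'. (a, a') \<in> \<pi> \<longrightarrow> (b, b') \<in> \<pi> \<longrightarrow> ((a, b) \<in> E \<longleftrightarrow> (a', b') \<in> E))"

definition image_rel :: "('a \<times> 'a) set \<Rightarrow> 'a list set \<Rightarrow> 'a list set" where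
  "image_rel \<pi> R = {bs. \<exists>as\<in>R. tup_rel \<pi> as bs}"

lemma image_rel_tuples: "R \<subseteq> tuples k \<Longrightarrow> image_rel \<pi> R \<subseteq> tuples k"
  unfolding image_rel_def tuples_def using tup_rel_length by fastforce

lemma compatible_tup:
  assumes "compatible E \<pi>" "tup_rel \<pi> as as'" "tup_rel \<pi> bs bs'"
  shows "tup_rel E as bs \<longleftrightarrow> tup_rel E as' bs'"
proof -
  have "(as ! i, bs ! i) \<in> E \<longleftrightarrow> (as' ! i, bs' ! i) \<in> E" if "i < length as" "i < length bs" for i
    using assms that unfolding compatible_def tup_rel_iff_nth by blast
  then show ?thesis using assms(2,3) by (auto simp: tup_rel_iff_nth)
qed

text \<open>A tuple outside \<open>R\<close> could share an image with one inside; compatibility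
  makes two such tuples \<open>E\<close>-related, and invariance of \<open>R\<close> then rules this
  out.\<close>

lemma sim_rel_image_rel:
  assumes "compatible E \<pi>" "refl E" "rel_inv E k R"
  shows "sim_rel \<pi> k R (image_rel \<pi> R)"
  unfolding sim_rel_def
proof (intro allI impI iffI)
  fix as bs assume *: "length as = k" "tup_rel \<pi> as bs"
  show "bs \<in> image_rel \<pi> R" if "as \<in> R"
    using that * by (auto simp: image_rel_def)
  assume "bs \<in> image_rel \<pi> R"
  then obtain as' where as': "as' \<in> R" "tup_rel \<pi> as' bs" by (auto simp: image_rel_def)
  moreover have "tup_rel E bs bs" using \<open>refl E\<close> by (auto intro: tup_rel_refl simp: refl_on_def)
  ultimately have "tup_rel E as as'" using compatible_tup[OF assms(1) *(2) as'(2)] by blast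
  then show "as \<in> R" using rel_invD[OF assms(3) *(1)] as' by blast
qed

lemma rel_inv_sim_rel:
  assumes "compatible E \<pi>" "similarity \<pi>" "rel_inv E k R" "sim_rel \<pi> k R S"
  shows "rel_inv E k S"
  unfolding rel_inv_def sim_rel_def
proof (intro allI impI)
  fix bs bs' assume *: "length bs = k" "tup_rel E bs bs'"
  obtain as where as: "tup_rel \<pi> as bs" by (rule similarity_tup_left[OF assms(2)])
  obtain as' where as': "tup_rel \<pi> as' bs'" by (rule similarity_tup_left[OF assms(2)])
  have E: "tup_rel E as as'" using * compatible_tup[OF assms(1) as as'] by blast
  have k: "length as = k" "length as' = k"
    using as as' * by (auto dest!: tup_rel_length)
  show "bs \<in> S \<longleftrightarrow> bs' \<in> S"
    using rel_invD[OF assms(3) k(1) E] sim_relD[OF assms(4) k(1) as] sim_relD[OF assms(4) k(2) as']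
    by blast
qed

text \<open>Every tuple of \<open>S\<close> has a preimage, so the partner of \<open>R\<close> is
  unique. A condition on all pairs \<open>R\<close>, \<open>S\<close> thereby becomes a condition on
  \<open>R\<close> alone, which a formula can state.\<close>

lemma sim_rel_imp_image_rel:
  assumes "similarity \<pi>" "sim_rel \<pi> k R S" "R \<subseteq> tuples k" "S \<subseteq> tuples k"
  shows "S = image_rel \<pi> R"
proof (intro set_eqI iffI)
  fix bs assume bs: "bs \<in> S"
  obtain as where as: "tup_rel \<pi> as bs" by (rule similarity_tup_left[OF assms(1)])
  moreover have "length as = k" using bs as assms(4) by (auto simp: tuples_def dest!: tup_rel_length)
  ultimately show "bs \<in> image_rel \<pi> R" using bs sim_relD[OF assms(2)] by (auto simp: image_rel_def)
next
  fix bs assume "bs \<in> image_rel \<pi> R"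
  then show "bs \<in> S" using sim_relD[OF assms(2)] assms(3) by (auto simp: image_rel_def tuples_def)
qed

text \<open>Shrinking a similarity weakens the premise in \<open>quant_inv\<close>, so closure under
  subsimilarities is not automatic. It holds because a \<open>\<pi>\<close>-preimage and a
  \<open>\<pi>'\<close>-preimage of the same tuple are \<open>E\<close>-related.\<close>

lemma sim_rel_subset:
  assumes "compatible E \<pi>" "refl E" "\<pi>' \<subseteq> \<pi>" "similarity \<pi>'" "rel_inv E k R" "sim_rel \<pi>' k R S"
  shows "sim_rel \<pi> k R S"
  unfolding sim_rel_def
proof (intro allI impI)
  fix as bs assume *: "length as = k" "tup_rel \<pi> as bs"
  obtain as' where as': "tup_rel \<pi>' as' bs" by (rule similarity_tup_left[OF assms(4)])
  moreover have "tup_rel E bs bs" using \<open>refl E\<close> by (auto intro: tup_rel_refl simp: refl_on_def)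
  ultimately have "tup_rel E as as'"
    using compatible_tup[OF assms(1) *(2)] tup_rel_mono[OF _ assms(3)] by blast
  moreover have "length as' = k" using as' * by (auto dest!: tup_rel_length)
  ultimately show "as \<in> R \<longleftrightarrow> bs \<in> S"
    using rel_invD[OF assms(5) *(1)] sim_relD[OF assms(6)] as' by blast
qed

section \<open>Updating assignments along tuples\<close>

lemma upds_Nil [simp]: "upds s [] as = s" "upds s vs [] = s"
  by (auto simp: upds_def)

lemma upds_Cons [simp]: "upds s (v # vs) (a # as) = upds (s(v := a)) vs as"
  by (auto simp: upds_def)

lemma upds_rel:
  "tup_rel \<pi> as bs \<Longrightarrow> \<forall>v. (s v, t v) \<in> \<pi> \<Longrightarrow> (upds s vs as v, upds t vs bs v) \<in> \<pi>"
proof (induction vs arbitrary: s t as bs)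
  case (Cons w vs)
  then show ?case by (cases as; cases bs) auto
qed simp

lemma upds_notin: "v \<notin> set vs \<Longrightarrow> upds s vs as v = s v"
proof (induction vs arbitrary: s as)
  case (Cons w vs)
  then show ?case by (cases as) auto
qed simp

lemma map_upds: "distinct vs \<Longrightarrow> length as = length vs \<Longrightarrow> map (upds s vs as) vs = as"
proof (induction vs arbitrary: s as)
  case (Cons w vs)
  then show ?case by (cases as) (auto simp: upds_notin)
qed simp

lemma upds_comp: "inj \<rho> \<Longrightarrow> upds s (map \<rho> vs) as \<circ> \<rho> = upds (s \<circ> \<rho>) vs as"
proof (induction vs arbitrary: s as)
  case (Cons w vs)
  have "s(\<rho> w := a) \<circ> \<rho> = (s \<circ> \<rho>)(w := a)" for a
    using Cons.prems by (auto simp: fun_eq_iff inj_eq)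
  then show ?case using Cons by (cases as) (simp_all del: o_apply)
qed simp

lemma rel_of_tuples: "rel_of S s vs \<subseteq> tuples (length vs)"
  by (auto simp: rel_of_def tuples_def)

section \<open>Closure properties of formulas\<close>

text \<open>The closure rules are phrased for predicates inside a set comprehension, so that
  formulas can be assembled by backward resolution along their logical structure.\<close>

lemma fmlx_not:
  "(\<lambda>P. {s. \<phi> P s}) \<in> fmlx q ks \<Longrightarrow> (\<lambda>P. {s. \<not> \<phi> P s}) \<in> fmlx q ks"
  by (drule fmlx.neg) (simp add: Collect_neg_eq)

lemma fmlx_all:
  assumes "\<And>i. i \<in> I \<Longrightarrow> (\<lambda>P. {s. \<phi> i P s}) \<in> fmlx q ks"
  shows "(\<lambda>P. {s. \<forall>i\<in>I. \<phi> i P s}) \<in> fmlx q ks"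
proof -
  have "(\<lambda>P. \<Inter>f\<in>(\<lambda>i P. {s. \<phi> i P s}) ` I. f P) \<in> fmlx q ks"
    using assms by (intro fmlx.conj) auto
  moreover have "(\<lambda>P. \<Inter>f\<in>(\<lambda>i P. {s. \<phi> i P s}) ` I. f P) = (\<lambda>P. {s. \<forall>i\<in>I. \<phi> i P s})"
    by auto
  ultimately show ?thesis by simp
qed

lemma fmlx_ex:
  assumes "\<And>i. i \<in> I \<Longrightarrow> (\<lambda>P. {s. \<phi> i P s}) \<in> fmlx q ks"
  shows "(\<lambda>P. {s. \<exists>i\<in>I. \<phi> i P s}) \<in> fmlx q ks"
  using fmlx_not[OF fmlx_all, OF fmlx_not, OF assms] by simp

lemma fmlx_and:
  assumes "(\<lambda>P. {s. \<phi> P s}) \<in> fmlx q ks" "(\<lambda>P. {s. \<psi> P s}) \<in> fmlx q ks"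
  shows "(\<lambda>P. {s. \<phi> P s \<and> \<psi> P s}) \<in> fmlx q ks"
proof -
  have "(\<lambda>P. {s. \<forall>b\<in>UNIV. if b then \<phi> P s else \<psi> P s}) \<in> fmlx q ks"
  proof (rule fmlx_all)
    fix b show "(\<lambda>P. {s. if b then \<phi> P s else \<psi> P s}) \<in> fmlx q ks"
      using assms by (cases b) simp_all
  qed
  then show ?thesis by (simp add: all_bool_eq conj_commute)
qed

lemma fmlx_const: "(\<lambda>P. {s. b}) \<in> fmlx q ks"
  using fmlx_all[of "{}" "\<lambda>i P s. False" q ks] fmlx_not[OF fmlx_all[of "{}" "\<lambda>i P s. False" q ks]]
  by (cases b) simp_all

lemma fmlx_or:
  assumes "(\<lambda>P. {s. \<phi> P s}) \<in> fmlx q ks" "(\<lambda>P. {s. \<psi> P s}) \<in> fmlx q ks"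
  shows "(\<lambda>P. {s. \<phi> P s \<or> \<psi> P s}) \<in> fmlx q ks"
  using fmlx_not[OF fmlx_and[OF assms[THEN fmlx_not]]] by simp

lemma fmlx_iff:
  assumes "(\<lambda>P. {s. \<phi> P s}) \<in> fmlx q ks" "(\<lambda>P. {s. \<psi> P s}) \<in> fmlx q ks"
  shows "(\<lambda>P. {s. \<phi> P s \<longleftrightarrow> \<psi> P s}) \<in> fmlx q ks"
proof -
  have "(\<lambda>P. {s. (\<phi> P s \<and> \<psi> P s) \<or> (\<not> \<phi> P s \<and> \<not> \<psi> P s)}) \<in> fmlx q ks"
    by (intro fmlx_or fmlx_and fmlx_not assms)
  moreover have "(\<phi> P s \<and> \<psi> P s) \<or> (\<not> \<phi> P s \<and> \<not> \<psi> P s) \<longleftrightarrow> (\<phi> P s \<longleftrightarrow> \<psi> P s)" for P s by blast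
  ultimately show ?thesis by simp
qed

lemma fmlx_ex_var:
  "(\<lambda>P. {s. \<phi> P s}) \<in> fmlx q ks \<Longrightarrow>
    (\<lambda>P. {s. \<exists>t. (\<forall>v. v \<notin> W \<longrightarrow> t v = s v) \<and> \<phi> P t}) \<in> fmlx q ks"
  by (drule fmlx.ex[of _ _ _ W]) simp

lemma fmlx_all_var:
  assumes "(\<lambda>P. {s. \<phi> P s}) \<in> fmlx q ks"
  shows "(\<lambda>P. {s. \<forall>t. (\<forall>v. v \<notin> W \<longrightarrow> t v = s v) \<longrightarrow> \<phi> P t}) \<in> fmlx q ks"
  using fmlx_not[OF fmlx_ex_var, OF fmlx_not, OF assms, of W] by (simp add: imp_conv_disj)

text \<open>A formula may use every variable, so fresh ones are obtained by moving all variables,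
  free and bound, along an injection. Injectivity keeps bound variables apart from the
  others.\<close>

lemma fmlx_rename:
  fixes f :: "'a list set list \<Rightarrow> ('v \<Rightarrow> 'a) set" and \<rho> :: "'v \<Rightarrow> 'w"
  assumes "f \<in> fmlx q []" "inj \<rho>"
  shows "(\<lambda>P. {s. s \<circ> \<rho> \<in> f []}) \<in> fmlx q ks"
  using assms(1)
proof induction
  case (atom k R ys)
  then have "(\<lambda>P. {s. map s (map \<rho> ys) \<in> R}) \<in> fmlx q ks" by (intro fmlx.atom) auto
  then show ?case by (simp add: comp_def)
next
  case (neg f)
  then show ?case by (auto intro: fmlx_not)
next
  case (conj F)
  then have "(\<lambda>P. {s. \<forall>f\<in>F. s \<circ> \<rho> \<in> f []}) \<in> fmlx q ks" by (intro fmlx_all) (auto simp: comp_def)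
  then show ?case by (simp add: comp_def)
next
  case (ex f W)
  have "(\<exists>t. (\<forall>v. v \<notin> W \<longrightarrow> t v = (s \<circ> \<rho>) v) \<and> t \<in> f []) \<longleftrightarrow>
        (\<exists>t. (\<forall>v. v \<notin> \<rho> ` W \<longrightarrow> t v = s v) \<and> t \<circ> \<rho> \<in> f [])" (is "?L \<longleftrightarrow> ?R") for s :: "'w \<Rightarrow> 'a"
  proof
    assume ?L
    then obtain t where t: "\<forall>v. v \<notin> W \<longrightarrow> t v = (s \<circ> \<rho>) v" "t \<in> f []" by blast
    \<comment> \<open>\<open>t'\<close> carries \<open>t\<close> over to the renamed variables and
      keeps \<open>s\<close> on all others.\<close>
    define t' where "t' v = (if v \<in> range \<rho> then t (inv \<rho> v) else s v)" for v
    have "t' \<circ> \<rho> = t" using \<open>inj \<rho>\<close> by (auto simp: t'_def fun_eq_iff)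
    moreover have "t' v = s v" if "v \<notin> \<rho> ` W" for v
      using that t(1) \<open>inj \<rho>\<close> by (auto simp: t'_def)
    ultimately show ?R using t by blast
  next
    assume ?R
    then obtain t where "\<forall>v. v \<notin> \<rho> ` W \<longrightarrow> t v = s v" "t \<circ> \<rho> \<in> f []" by blast
    then show ?L using \<open>inj \<rho>\<close> by (intro exI[of _ "t \<circ> \<rho>"]) (auto simp: inj_image_mem_iff)
  qed
  then show ?case using fmlx_ex_var[OF ex.IH, of "\<rho> ` W"] by (simp add: comp_def)
next
  case (quant ls Q xss fs)
  define gs :: "('a list set list \<Rightarrow> ('w \<Rightarrow> 'a) set) list"
    where "gs = map (\<lambda>f P. {s. s \<circ> \<rho> \<in> f []}) fs"
  define yss where "yss = map (map \<rho>) xss"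
  have "(\<lambda>P. {s. map (\<lambda>i. rel_of ((gs ! i) P) s (yss ! i)) [0..<length ls] \<in> Q}) \<in> fmlx q ks"
    using quant \<open>inj \<rho>\<close>
    by (intro fmlx.quant) (auto simp: gs_def yss_def distinct_map inj_on_def inj_def comp_def)
  moreover have "rel_of ((gs ! i) P) s (yss ! i) = rel_of ((fs ! i) []) (s \<circ> \<rho>) (xss ! i)"
    if "i < length ls" for i P s
    using that quant \<open>inj \<rho>\<close> by (auto simp: rel_of_def gs_def yss_def upds_comp)
  then have "map (\<lambda>i. rel_of ((gs ! i) P) s (yss ! i)) [0..<length ls] =
      map (\<lambda>i. rel_of ((fs ! i) []) (s \<circ> \<rho>) (xss ! i)) [0..<length ls]" for P s
    by simp
  ultimately show ?case by (simp add: comp_def)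
qed simp

section \<open>Fresh variables and the definability of indistinguishability\<close>

lemma ex_inj_avoiding:
  assumes "infinite (UNIV :: 'v set)"
  obtains \<rho> :: "'v \<Rightarrow> 'v" where "inj \<rho>" "x \<notin> range \<rho>" "y \<notin> range \<rho>"
proof -
  have inf: "infinite (UNIV - {x})" using assms by simp
  obtain g :: "'v \<Rightarrow> 'v" where g: "bij_betw g UNIV (UNIV - {x})" using infinite_imp_bij_betw[OF assms, of x] by blast
  obtain h :: "'v \<Rightarrow> 'v" where h: "bij_betw h (UNIV - {x}) (UNIV - {x} - {y})"
    using infinite_imp_bij_betw[OF inf, of y] by blast
  have "bij_betw (h \<circ> g) UNIV (UNIV - {x} - {y})" by (rule bij_betw_trans[OF g h])
  then have "inj (h \<circ> g)" "range (h \<circ> g) = UNIV - {x} - {y}" by (simp_all add: bij_betw_def)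
  then show thesis by (intro that[of "h \<circ> g"]) blast+
qed

lemma simeq_refl: "(a, a) \<in> simeq vt q"
  by (auto simp: simeq_def)

lemma refl_simeq: "refl (simeq vt q)"
  by (auto simp: refl_on_def simeq_refl)

text \<open>Formulas are identified with their meanings and hence form a set, so the definition of
  \<open>simeq\<close> can be written as one conjunction over all of them. Renaming keeps their own
  variables away from \<open>x\<close> and \<open>y\<close>.\<close>

lemma fmlx_simeq:
  fixes x y :: 'v
  assumes "infinite (UNIV :: 'v set)"
  shows "(\<lambda>P. {s :: 'v \<Rightarrow> 'a. (s x, s y) \<in> simeq TYPE('v) q}) \<in> fmlx q ks"
proof -
  obtain \<rho> :: "'v \<Rightarrow> 'v" where \<rho>: "inj \<rho>" "x \<notin> range \<rho>" "y \<notin> range \<rho>"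
    by (rule ex_inj_avoiding[OF assms, of x y])
  have inj: "inj (\<rho>(w := x))" "inj (\<rho>(w := y))" for w
    using \<rho> by (blast intro: inj_on_fun_updI)+
  \<comment> \<open>The renaming \<open>\<rho>(w := x)\<close> substitutes \<open>x\<close> for
    \<open>w\<close>. Quantifying over \<open>range \<rho>\<close> lets all parameters vary, while
    \<open>x\<close> and \<open>y\<close>, lying outside that range, keep the values given by
    \<open>s\<close>.\<close>
  have "(\<lambda>P. {s. \<forall>f\<in>fmlx q []. \<forall>w\<in>UNIV. \<forall>t. (\<forall>v. v \<notin> range \<rho> \<longrightarrow> t v = s v) \<longrightarrow>
      (t \<circ> \<rho>(w := x) \<in> f [] \<longleftrightarrow> t \<circ> \<rho>(w := y) \<in> f [])}) \<in> fmlx q ks"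
  proof (rule fmlx_all, rule fmlx_all, rule fmlx_all_var, rule fmlx_iff)
    fix f :: "'a list set list \<Rightarrow> ('v \<Rightarrow> 'a) set" and w assume f: "f \<in> fmlx q []"
    show "(\<lambda>P. {s. s \<circ> \<rho>(w := x) \<in> f []}) \<in> fmlx q ks" by (rule fmlx_rename[OF f inj(1)])
    show "(\<lambda>P. {s. s \<circ> \<rho>(w := y) \<in> f []}) \<in> fmlx q ks" by (rule fmlx_rename[OF f inj(2)])
  qed
  moreover have "(\<forall>t. (\<forall>v. v \<notin> range \<rho> \<longrightarrow> t v = s v) \<longrightarrow>
      (t \<circ> \<rho>(w := x) \<in> S \<longleftrightarrow> t \<circ> \<rho>(w := y) \<in> S)) \<longleftrightarrow>
     (\<forall>t. t(w := s x) \<in> S \<longleftrightarrow> t(w := s y) \<in> S)" (is "?L \<longleftrightarrow> ?R")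
    for w S and s :: "'v \<Rightarrow> 'a"
  proof
    assume L: ?L
    show ?R
    proof
      fix t
      define t' where "t' v = (if v \<in> range \<rho> then t (inv \<rho> v) else s v)" for v
      have "t' \<circ> \<rho>(w := x) = t(w := s x)" "t' \<circ> \<rho>(w := y) = t(w := s y)"
        using \<rho> by (simp_all add: t'_def fun_eq_iff)
      moreover have "\<forall>v. v \<notin> range \<rho> \<longrightarrow> t' v = s v" by (simp add: t'_def)
      ultimately show "t(w := s x) \<in> S \<longleftrightarrow> t(w := s y) \<in> S"
        using L[rule_format, of t'] by (simp only:) blast
    qed
  next
    assume R: ?R
    show ?L
    proof (intro allI impI)
      fix t assume t: "\<forall>v. v \<notin> range \<rho> \<longrightarrow> t v = s v"
      have "t x = s x" "t y = s y" using t \<rho> by blast+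
      then have "t \<circ> \<rho>(w := x) = (t \<circ> \<rho>)(w := s x)" "t \<circ> \<rho>(w := y) = (t \<circ> \<rho>)(w := s y)"
        by (simp_all add: fun_eq_iff)
      then show "t \<circ> \<rho>(w := x) \<in> S \<longleftrightarrow> t \<circ> \<rho>(w := y) \<in> S" using R by simp
    qed
  qed
  moreover have "(a, b) \<in> simeq TYPE('v) q \<longleftrightarrow>
      (\<forall>f\<in>fmlx q []. \<forall>w\<in>UNIV. \<forall>t. t(w := a) \<in> f [] \<longleftrightarrow> (t :: 'v \<Rightarrow> 'a)(w := b) \<in> f [])" for a b
    by (simp add: simeq_def fml_def)
  ultimately show ?thesis by simp
qed

section \<open>Invariance of formulas\<close>

text \<open>Quantifiers impose no condition on \<open>E\<close> here: at assignments that agree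
up to \<open>E\<close> they are applied to literally the same relations.\<close>

lemma fmlx_rel_inv:
  fixes s t :: "'v \<Rightarrow> 'a"
  assumes "f \<in> fmlx q ks" and refl: "\<And>a. (a, a) \<in> E"
    and rels: "\<And>k R. Rel k R \<in> q \<Longrightarrow> rel_inv E k R"
    and P: "\<forall>i<length ks. rel_inv E (ks ! i) (P ! i)"
    and "\<forall>v. (s v, t v) \<in> E"
  shows "s \<in> f P \<longleftrightarrow> t \<in> f P"
  using assms(1,5)
proof (induction arbitrary: s t)
  case (atom k R ys)
  then have "tup_rel E (map s ys) (map t ys)" by (auto simp: tup_rel_iff_nth)
  then show ?case using rel_invD[OF rels[OF atom(1)], of "map s ys"] atom by auto
next
  case (newatom i ys)
  then have "tup_rel E (map s ys) (map t ys)" by (auto simp: tup_rel_iff_nth)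
  then show ?case using rel_invD[OF P[rule_format, OF newatom(1)], of "map s ys"] newatom by auto
next
  case (neg f)
  then show ?case by auto
next
  case (conj F)
  then show ?case by blast
next
  case (ex f W)
  \<comment> \<open>\<open>E\<close> is only reflexive, not symmetric, so the transfer of the
    witness is proved for both orientations at once.\<close>
  have *: "s' \<in> {s. \<exists>t. (\<forall>v. v \<notin> W \<longrightarrow> t v = s v) \<and> t \<in> f P}"
    if t': "t' \<in> {s. \<exists>t. (\<forall>v. v \<notin> W \<longrightarrow> t v = s v) \<and> t \<in> f P}" and
       st: "(\<forall>v. (s' v, t' v) \<in> E) \<or> (\<forall>v. (t' v, s' v) \<in> E)" for s' t'
  proof -
    obtain u where u: "\<forall>v. v \<notin> W \<longrightarrow> u v = t' v" "u \<in> f P" using t' by blast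
    define u' where "u' v = (if v \<in> W then u v else s' v)" for v
    have "(\<forall>v. (u' v, u v) \<in> E) \<or> (\<forall>v. (u v, u' v) \<in> E)"
      using st u(1) refl by (simp add: u'_def) blast
    then have "u' \<in> f P" using ex.IH[of u' u] ex.IH[of u u'] u(2) by blast
    moreover have "\<forall>v. v \<notin> W \<longrightarrow> u' v = s' v" by (simp add: u'_def)
    ultimately show ?thesis by blast
  qed
  show ?case using *[of s t] *[of t s] ex.prems by blast
next
  case (quant ls Q xss fs)
  have "rel_of ((fs ! i) P) s (xss ! i) = rel_of ((fs ! i) P) t (xss ! i)" if "i < length ls" for i
  proof -
    have "upds s (xss ! i) as \<in> (fs ! i) P \<longleftrightarrow> upds t (xss ! i) as \<in> (fs ! i) P" for as
    proof -
      have "\<forall>v. (upds s (xss ! i) as v, upds t (xss ! i) as v) \<in> E"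
        using upds_rel[OF tup_rel_refl[OF refl] quant.prems] by simp
      moreover have "fs ! i \<in> set fs" using quant.hyps that by simp
      ultimately show ?thesis using quant.IH by blast
    qed
    then show ?thesis by (auto simp: rel_of_def)
  qed
  then have "map (\<lambda>i. rel_of ((fs ! i) P) s (xss ! i)) [0..<length ls] =
      map (\<lambda>i. rel_of ((fs ! i) P) t (xss ! i)) [0..<length ls]"
    by simp
  then show ?case by (simp only: mem_Collect_eq)
qed

section \<open>Invariance of formulas under the similarities of q\<close>

lemma Sim_similarity: "\<pi> \<in> Sim vt q \<Longrightarrow> similarity \<pi>"
  by (auto simp: Sim_def)

lemma Sim_rel: "\<pi> \<in> Sim vt q \<Longrightarrow> Rel k R \<in> q \<Longrightarrow> rel_inv \<pi> k R"
  by (fastforce simp: Sim_def split: oper.splits)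

lemma Sim_quant: "\<pi> \<in> Sim vt q \<Longrightarrow> Quant ks Q \<in> q \<Longrightarrow> quant_inv (simeq vt q) \<pi> ks Q"
  by (fastforce simp: Sim_def split: oper.splits)

lemma SimI:
  assumes "similarity \<pi>" "\<And>k R. Rel k R \<in> q \<Longrightarrow> rel_inv \<pi> k R"
    "\<And>ks Q. Quant ks Q \<in> q \<Longrightarrow> quant_inv (simeq vt q) \<pi> ks Q"
  shows "\<pi> \<in> Sim vt q"
  using assms by (auto simp: Sim_def split: oper.splits)

lemma quant_invI:
  assumes "\<And>Rs Ss. Rs \<in> rels_of_type ks \<Longrightarrow> Ss \<in> rels_of_type ks \<Longrightarrow>
     (\<forall>i<length ks. rel_inv E (ks ! i) (Rs ! i)) \<Longrightarrow> (\<forall>i<length ks. rel_inv E (ks ! i) (Ss ! i)) \<Longrightarrow>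
     (\<forall>i<length ks. sim_rel \<pi> (ks ! i) (Rs ! i) (Ss ! i)) \<Longrightarrow> Rs \<in> Q \<longleftrightarrow> Ss \<in> Q"
  shows "quant_inv E \<pi> ks Q"
  using assms by (simp add: quant_inv_def)

lemma quant_invD:
  assumes "quant_inv E \<pi> ks Q" "Rs \<in> rels_of_type ks" "Ss \<in> rels_of_type ks"
     "\<forall>i<length ks. rel_inv E (ks ! i) (Rs ! i)" "\<forall>i<length ks. rel_inv E (ks ! i) (Ss ! i)"
     "\<forall>i<length ks. sim_rel \<pi> (ks ! i) (Rs ! i) (Ss ! i)"
  shows "Rs \<in> Q \<longleftrightarrow> Ss \<in> Q"
  using assms by (simp add: quant_inv_def)

lemma ex_inj_nat:
  assumes "infinite (UNIV :: 'v set)" obtains z :: "nat \<Rightarrow> 'v" where "inj z"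
  using infinite_countable_subset[OF assms] by blast

text \<open>The atomic formula for \<open>R\<close> with distinct variables is among those that
  \<open>simeq\<close> cannot separate, one variable at a time.\<close>

lemma rel_inv_simeq:
  fixes q :: "'a oper set"
  assumes inf: "infinite (UNIV :: 'v set)" and q: "Rel k R \<in> q"
  shows "rel_inv (simeq TYPE('v) q) k R"
proof (rule rel_inv_coordinatewise)
  fix a b :: 'a and as bs :: "'a list" assume ab: "(a, b) \<in> simeq TYPE('v) q" and k: "length as + length bs + 1 = k"
  obtain z :: "nat \<Rightarrow> 'v" where z: "inj z" by (rule ex_inj_nat[OF inf])
  let ?n = "length as"
  let ?vs = "map z [0..<k]"
  \<comment> \<open>Only the values at \<open>z 0\<close>, ..., \<open>z (k - 1)\<close> matter;
    elsewhere \<open>s\<close> is arbitrary.\<close>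
  define s where "s v = (as @ a # bs) ! inv z v" for v
  have "(\<lambda>P. {s. map s ?vs \<in> R}) \<in> fmlx q []" using q by (intro fmlx.atom) auto
  then have S: "{s. map s ?vs \<in> R} \<in> fml q" unfolding fml_def by (rule rev_image_eqI) simp
  have "\<forall>S\<in>fml q. \<forall>(x :: 'v) s. s(x := a) \<in> S \<longleftrightarrow> s(x := b) \<in> S"
    using ab by (simp add: simeq_def)
  from this[rule_format, OF S, of s "z ?n"]
  have "map (s(z ?n := a)) ?vs \<in> R \<longleftrightarrow> map (s(z ?n := b)) ?vs \<in> R" by (simp only: mem_Collect_eq)
  moreover have "map (s(z ?n := c)) ?vs = as @ c # bs" for c
    using k by (intro nth_equalityI) (auto simp: s_def nth_append inj_eq[OF z] inv_f_f[OF z] nth_Cons')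
  ultimately show "as @ a # bs \<in> R \<longleftrightarrow> as @ b # bs \<in> R" by simp
qed

text \<open>Totality of \<open>\<pi>\<close> on both sides handles the existential quantifier as in
  a back-and-forth argument. For generalized quantifiers, \<open>fmlx_rel_inv\<close> first shows
  that the relations they are applied to are \<open>simeq\<close>-invariant, as
  \<open>quant_inv\<close> demands.\<close>

lemma fmlx_Sim_inv:
  fixes s t :: "'v \<Rightarrow> 'a"
  assumes inf: "infinite (UNIV :: 'v set)" and "f \<in> fmlx q ks" and \<pi>: "\<pi> \<in> Sim TYPE('v) q"
    and P: "\<forall>i<length ks. rel_inv (simeq TYPE('v) q) (ks ! i) (P ! i)"
    and P': "\<forall>i<length ks. rel_inv (simeq TYPE('v) q) (ks ! i) (P' ! i)"
    and sim: "\<forall>i<length ks. sim_rel \<pi> (ks ! i) (P ! i) (P' ! i)"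
    and "\<forall>v. (s v, t v) \<in> \<pi>"
  shows "s \<in> f P \<longleftrightarrow> t \<in> f P'"
  using assms(2,7)
proof (induction arbitrary: s t)
  case (atom k R ys)
  then have "tup_rel \<pi> (map s ys) (map t ys)" by (auto simp: tup_rel_iff_nth)
  then show ?case using rel_invD[OF Sim_rel[OF \<pi> atom(1)], of "map s ys"] atom by auto
next
  case (newatom i ys)
  then have "tup_rel \<pi> (map s ys) (map t ys)" by (auto simp: tup_rel_iff_nth)
  then show ?case using sim_relD[OF sim[rule_format, OF newatom(1)], of "map s ys"] newatom by auto
next
  case (neg f)
  then show ?case by auto
next
  case (conj F)
  then show ?case by blast
next
  case (ex f W)
  obtain g h where gh: "\<And>a. (a, g a) \<in> \<pi>" "\<And>a. (h a, a) \<in> \<pi>"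
    using similarity_left[OF Sim_similarity[OF \<pi>]] similarity_right[OF Sim_similarity[OF \<pi>]]
      choice[of "\<lambda>a b. (a, b) \<in> \<pi>"] choice[of "\<lambda>b a. (a, b) \<in> \<pi>"] by blast
  have "\<exists>u'. (\<forall>v. v \<notin> W \<longrightarrow> u' v = t v) \<and> u' \<in> f P'"
    if u: "\<forall>v. v \<notin> W \<longrightarrow> u v = s v" "u \<in> f P" for u
  proof (intro exI conjI)
    show "(\<lambda>v. if v \<in> W then g (u v) else t v) \<in> f P'"
      using ex.IH[of u "\<lambda>v. if v \<in> W then g (u v) else t v"] u ex.prems gh by auto
  qed auto
  moreover have "\<exists>u'. (\<forall>v. v \<notin> W \<longrightarrow> u' v = s v) \<and> u' \<in> f P"
    if u: "\<forall>v. v \<notin> W \<longrightarrow> u v = t v" "u \<in> f P'" for u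
  proof (intro exI conjI)
    show "(\<lambda>v. if v \<in> W then h (u v) else s v) \<in> f P"
      using ex.IH[of "\<lambda>v. if v \<in> W then h (u v) else s v" u] u ex.prems gh by auto
  qed auto
  ultimately show ?case by blast
next
  case (quant ls Q xss fs)
  let ?E = "simeq TYPE('v) q"
  have fs: "fs ! i \<in> fmlx q ks" if "i < length ls" for i using quant that by auto
  have inv: "rel_inv ?E (ls ! i) (rel_of ((fs ! i) p) u (xss ! i))"
    if i: "i < length ls" and p: "\<forall>i<length ks. rel_inv ?E (ks ! i) (p ! i)" for i p u
    unfolding rel_inv_def sim_rel_def
  proof (intro allI impI)
    fix as bs assume *: "length as = ls ! i" "tup_rel ?E as bs"
    have "upds u (xss ! i) as \<in> (fs ! i) p \<longleftrightarrow> upds u (xss ! i) bs \<in> (fs ! i) p"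
      by (rule fmlx_rel_inv[OF fs[OF i] simeq_refl rel_inv_simeq[OF inf] p], assumption,
          rule allI, rule upds_rel[OF *(2)]) (simp add: simeq_refl)
    then show "as \<in> rel_of ((fs ! i) p) u (xss ! i) \<longleftrightarrow> bs \<in> rel_of ((fs ! i) p) u (xss ! i)"
      using * by (auto simp: rel_of_def dest: tup_rel_length)
  qed
  have sim': "sim_rel \<pi> (ls ! i) (rel_of ((fs ! i) P) s (xss ! i)) (rel_of ((fs ! i) P') t (xss ! i))"
    if i: "i < length ls" for i
    unfolding sim_rel_def
  proof (intro allI impI)
    fix as bs assume *: "length as = ls ! i" "tup_rel \<pi> as bs"
    have "\<forall>v. (upds s (xss ! i) as v, upds t (xss ! i) bs v) \<in> \<pi>"
      by (rule allI, rule upds_rel[OF *(2) quant.prems])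
    moreover have "fs ! i \<in> set fs" using quant.hyps i by simp
    ultimately have "upds s (xss ! i) as \<in> (fs ! i) P \<longleftrightarrow> upds t (xss ! i) bs \<in> (fs ! i) P'"
      using quant.IH by blast
    then show "as \<in> rel_of ((fs ! i) P) s (xss ! i) \<longleftrightarrow> bs \<in> rel_of ((fs ! i) P') t (xss ! i)"
      using * by (auto simp: rel_of_def dest: tup_rel_length)
  qed
  have rels: "map (\<lambda>i. rel_of ((fs ! i) p) u (xss ! i)) [0..<length ls] \<in> rels_of_type ls" for p u
    using quant rel_of_tuples by (fastforce simp: rels_of_type_def)
  show ?case
    using quant_invD[OF Sim_quant[OF \<pi> quant(1)] rels rels, of P s P' t] inv[OF _ P] inv[OF _ P'] sim'
    by simp
qed

lemma fml_Sim_inv: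
  fixes s t :: "'v \<Rightarrow> 'a"
  assumes "infinite (UNIV :: 'v set)" "S \<in> fml q" "\<pi> \<in> Sim TYPE('v) q" "\<forall>v. (s v, t v) \<in> \<pi>"
  shows "s \<in> S \<longleftrightarrow> t \<in> S"
  using assms fmlx_Sim_inv[where ks = "[]"] by (fastforce simp: fml_def)

text \<open>By \<open>fmlx_simeq\<close> indistinguishability is itself a formula, hence preserved
  like any other.\<close>

lemma compatible_simeq:
  assumes inf: "infinite (UNIV :: 'v set)" and \<pi>: "\<pi> \<in> Sim TYPE('v) q"
  shows "compatible (simeq TYPE('v) q) \<pi>"
  unfolding compatible_def
proof (intro allI impI)
  fix a a' b b' assume *: "(a, a') \<in> \<pi>" "(b, b') \<in> \<pi>"
  obtain z :: "nat \<Rightarrow> 'v" where z: "inj z" by (rule ex_inj_nat[OF inf])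
  define s where "s c d v = (if v = z 0 then c else d)" for c d :: 'a and v
  have "{s. (s (z 0), s (z 1)) \<in> simeq TYPE('v) q} \<in> fml q"
    using fmlx_simeq[OF inf, of "z 0" "z 1" q "[]"] unfolding fml_def by (rule rev_image_eqI) simp
  from fml_Sim_inv[OF inf this \<pi>, of "s a b" "s a' b'"]
  show "(a, b) \<in> simeq TYPE('v) q \<longleftrightarrow> (a', b') \<in> simeq TYPE('v) q"
    using * z by (auto simp: s_def inj_eq)
qed

text \<open>By reflexivity, relations that correspond under \<open>simeq\<close> are equal, so the
  condition on quantifiers is trivial.\<close>

lemma simeq_in_Sim:
  assumes inf: "infinite (UNIV :: 'v set)"
  shows "simeq TYPE('v) q \<in> Sim TYPE('v) q"
proof (rule SimI)
  show "similarity (simeq TYPE('v) q)" using simeq_refl by (fastforce simp: similarity_def)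
next
  fix ks Q assume "Quant ks Q \<in> q"
  show "quant_inv (simeq TYPE('v) q) (simeq TYPE('v) q) ks Q"
  proof (rule quant_invI)
    fix Rs Ss assume *: "Rs \<in> rels_of_type ks" "Ss \<in> rels_of_type ks"
      "\<forall>i<length ks. sim_rel (simeq TYPE('v) q) (ks ! i) (Rs ! i) (Ss ! i)"
    have "Rs ! i = Ss ! i" if i: "i < length ks" for i
    proof -
      have "as \<in> Rs ! i \<longleftrightarrow> as \<in> Ss ! i" if "length as = ks ! i" for as
        using *(3) i that by (intro sim_relD[OF _ that tup_rel_refl]) (auto simp: simeq_refl)
      then show ?thesis using * i unfolding rels_of_type_def tuples_def by blast
    qed
    then have "Rs = Ss" using * by (intro nth_equalityI) (auto simp: rels_of_type_def)
    then show "Rs \<in> Q \<longleftrightarrow> Ss \<in> Q" by simp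
  qed
qed (rule rel_inv_simeq[OF inf])

text \<open>This makes the congruence used in \<open>Inv (Sim q)\<close> coincide with the one used
  in \<open>Sim q\<close>.\<close>

lemma approx_Sim:
  assumes inf: "infinite (UNIV :: 'v set)"
  shows "approx (Sim TYPE('v) q) = simeq TYPE('v) q"
proof (intro set_eqI iffI)
  fix p assume p: "p \<in> approx (Sim TYPE('v) q)"
  obtain a b where ab: "p = (a, b)" by (cases p)
  \<comment> \<open>The parameter is \<open>a\<close> itself: \<open>\<pi>\<close> sends
    \<open>a\<close> both to \<open>b\<close> and to \<open>a\<close>, so compatibility yields that
    these are indistinguishable.\<close>
  obtain \<pi> where \<pi>: "\<pi> \<in> Sim TYPE('v) q" "tup_rel \<pi> [a, a] [b, a]"
    using p unfolding ab approx_def by blast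
  then have "(a, a) \<in> simeq TYPE('v) q \<longleftrightarrow> (a, b) \<in> simeq TYPE('v) q"
    using compatible_simeq[OF inf \<pi>(1)] unfolding compatible_def tup_rel_simps by blast
  then show "p \<in> simeq TYPE('v) q" by (simp add: ab simeq_refl)
next
  fix p assume "p \<in> simeq TYPE('v) q"
  then show "p \<in> approx (Sim TYPE('v) q)"
    using simeq_in_Sim[OF inf] by (auto simp: approx_def intro!: bexI[of _ "simeq TYPE('v) q"] tup_rel_refl simeq_refl)
qed

section \<open>Definability of the invariant operations\<close>

lemma depends_only_ex:
  fixes V :: "'v set"
  shows "depends_only {s. \<exists>t. (\<forall>v. v \<notin> - V \<longrightarrow> t v = s v) \<and> \<phi> t} V"
  unfolding depends_only_def
proof (intro allI impI)
  fix s s' :: "'v \<Rightarrow> 'a" assume "\<forall>v\<in>V. s v = s' v"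
  then have "(\<forall>v. v \<notin> - V \<longrightarrow> t v = s v) \<longleftrightarrow> (\<forall>v. v \<notin> - V \<longrightarrow> t v = s' v)" for t by simp
  then show "s \<in> {s. \<exists>t. (\<forall>v. v \<notin> - V \<longrightarrow> t v = s v) \<and> \<phi> t} \<longleftrightarrow>
      s' \<in> {s. \<exists>t. (\<forall>v. v \<notin> - V \<longrightarrow> t v = s v) \<and> \<phi> t}" by (simp only: mem_Collect_eq)
qed

text \<open>The value of an assignment at \<open>y b\<close> names an image of \<open>b\<close>; the similarity it
encodes relates \<open>b\<close> to everything indistinguishable from that value. Membership of the encoded
similarity in \<open>Sim q\<close> is expressible by a formula.\<close>

definition decoded :: "'a oper set \<Rightarrow> ('a \<Rightarrow> 'v) \<Rightarrow> ('v \<Rightarrow> 'a) \<Rightarrow> ('a \<times> 'a) set" where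
  "decoded q y s = {(b, c). (s (y b), c) \<in> simeq TYPE('v) q}"

lemma decoded_cong: "(\<And>b. s (y b) = t (y b)) \<Longrightarrow> decoded q y s = decoded q y t"
  by (simp add: decoded_def)

context
  fixes q :: "'a oper set" and y :: "'a \<Rightarrow> 'v" and z :: "nat \<Rightarrow> 'v"
  assumes inj_y: "inj y" and inj_z: "inj z" and y_z: "\<And>b n. y b \<noteq> z n"
begin

abbreviation (input) "zs k \<equiv> map z [0..<k]"

lemma infinite_vars: "infinite (UNIV :: 'v set)"
  using inj_z unfolding infinite_iff_countable_subset by blast

lemma distinct_zs: "distinct (zs k)"
  using inj_z by (simp add: distinct_map inj_on_def inj_def)

lemma y_zs: "y b \<notin> set (zs k)"
  using y_z by auto

lemma map_upds_zs: "length as = k \<Longrightarrow> map (upds s (zs k) as) (zs k) = as"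
  by (rule map_upds) (simp_all add: distinct_zs del: map_map)

lemma decoded_upds: "decoded q y (upds s (zs k) as) = decoded q y s"
  by (rule decoded_cong, rule upds_notin, rule y_zs)

text \<open>The assignment \<open>inv y\<close> gives \<open>y b\<close> the value \<open>b\<close>
  and so encodes the identity up to \<open>simeq\<close>. It is the witness that an invariant object
  occurs among its own images.\<close>

lemma decoded_inv: "decoded q y (inv y) = simeq TYPE('v) q"
  using inj_y by (simp add: decoded_def)

text \<open>A disjunction over the members of \<open>R\<close>, each of which is spelled out through
  the variables \<open>y\<close> naming the images of its entries.\<close>

lemma fmlx_image_rel:
  "(\<lambda>P. {s :: 'v \<Rightarrow> 'a. map s vs \<in> image_rel (decoded q y s) R}) \<in> fmlx q ks"
proof -
  have "(\<lambda>P. {s :: 'v \<Rightarrow> 'a. \<exists>bs\<in>R. length bs = length vs \<and>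
      (\<forall>j\<in>{..<length vs}. (s (y (bs ! j)), s (vs ! j)) \<in> simeq TYPE('v) q)}) \<in> fmlx q ks"
    by (rule fmlx_ex, rule fmlx_and, rule fmlx_const, rule fmlx_all, rule fmlx_simeq[OF infinite_vars])
  moreover have "map s vs \<in> image_rel (decoded q y s) R \<longleftrightarrow> (\<exists>bs\<in>R. length bs = length vs \<and>
      (\<forall>j\<in>{..<length vs}. (s (y (bs ! j)), s (vs ! j)) \<in> simeq TYPE('v) q))" for s :: "'v \<Rightarrow> 'a"
    by (auto simp: image_rel_def tup_rel_iff_nth decoded_def)
  ultimately show ?thesis by simp
qed

lemma rel_of_image_rel:
  assumes "R \<subseteq> tuples k"
  shows "rel_of {s. map s (zs k) \<in> image_rel (decoded q y s) R} s (zs k) = image_rel (decoded q y s) R"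
proof -
  have "as \<in> rel_of {s. map s (zs k) \<in> image_rel (decoded q y s) R} s (zs k) \<longleftrightarrow>
      as \<in> image_rel (decoded q y s) R" if "length as = k" for as
    using that by (simp add: rel_of_def map_upds_zs decoded_upds del: map_map)
  then show ?thesis
    using rel_of_tuples[of _ s "zs k"] image_rel_tuples[OF assms, of "decoded q y s"]
    by (fastforce simp: tuples_def simp del: map_map)
qed

text \<open>The quantifier binds only argument variables, so the encoded similarity stays fixed as a
  parameter. Different arguments may reuse the same \<open>z n\<close>, since each has its own
  binding.\<close>

lemma fmlx_quant_image_rel:
  assumes "Quant ls Q \<in> q" "Rs \<in> rels_of_type ls"
  shows "(\<lambda>P. {s :: 'v \<Rightarrow> 'a. map (\<lambda>i. image_rel (decoded q y s) (Rs ! i)) [0..<length ls] \<in> Q}) \<in> fmlx q ks"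
proof -
  define fs :: "('a list set list \<Rightarrow> ('v \<Rightarrow> 'a) set) list" where
    "fs = map (\<lambda>i P. {s. map s (zs (ls ! i)) \<in> image_rel (decoded q y s) (Rs ! i)}) [0..<length ls]"
  define xss where "xss = map zs ls"
  have "(\<lambda>P. {s. map (\<lambda>i. rel_of ((fs ! i) P) s (xss ! i)) [0..<length ls] \<in> Q}) \<in> fmlx q ks"
    using assms(1)
  proof (rule fmlx.quant)
    show "\<forall>f\<in>set fs. f \<in> fmlx q ks" by (auto simp: fs_def fmlx_image_rel simp del: map_map)
  qed (simp_all add: fs_def xss_def distinct_zs)
  moreover have "rel_of ((fs ! i) P) s (xss ! i) = image_rel (decoded q y s) (Rs ! i)"
    if "i < length ls" for i P s
  proof -
    have "Rs ! i \<subseteq> tuples (ls ! i)" using assms(2) that by (simp add: rels_of_type_def)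
    from rel_of_image_rel[OF this] show ?thesis using that by (simp add: fs_def xss_def del: map_map)
  qed
  then have "map (\<lambda>i. rel_of ((fs ! i) P) s (xss ! i)) [0..<length ls] =
      map (\<lambda>i. image_rel (decoded q y s) (Rs ! i)) [0..<length ls]" for P s
    by simp
  ultimately show ?thesis by (simp only:)
qed

text \<open>Each clause on the right can be written as a formula. Relations are tested only on the
  chosen images, because \<open>simeq\<close>-invariance extends this to all images; quantifiers are
  tested only on the pairs formed by an invariant \<open>Rs\<close> and its image, because no other
  partner exists. Totality on the left holds by construction.\<close>

lemma decoded_in_Sim_iff:
  "decoded q y s \<in> Sim TYPE('v) q \<longleftrightarrow>
     (\<forall>t. (\<forall>v. v \<notin> {z 0} \<longrightarrow> t v = s v) \<longrightarrow> (\<exists>b\<in>UNIV. (t (y b), t (z 0)) \<in> simeq TYPE('v) q)) \<and>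
     (\<forall>b\<in>UNIV. \<forall>b'\<in>UNIV. (s (y b), s (y b')) \<in> simeq TYPE('v) q \<longleftrightarrow> (b, b') \<in> simeq TYPE('v) q) \<and>
     (\<forall>p\<in>{p. Rel (fst p) (snd p) \<in> q}. \<forall>bs\<in>tuples (fst p).
        map s (map y bs) \<in> snd p \<longleftrightarrow> bs \<in> snd p) \<and>
     (\<forall>p\<in>{p. Quant (fst p) (snd p) \<in> q}.
        \<forall>Rs\<in>{Rs \<in> rels_of_type (fst p). \<forall>i<length (fst p). rel_inv (simeq TYPE('v) q) (fst p ! i) (Rs ! i)}.
        map (\<lambda>i. image_rel (decoded q y s) (Rs ! i)) [0..<length (fst p)] \<in> snd p \<longleftrightarrow> Rs \<in> snd p)"
  (is "?\<pi> \<in> _ \<longleftrightarrow> ?surj \<and> ?comp \<and> ?rels \<and> ?quants")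
proof -
  have surj: "?surj \<longleftrightarrow> (\<forall>c. \<exists>b. (b, c) \<in> ?\<pi>)"
  proof
    assume L: ?surj
    show "\<forall>c. \<exists>b. (b, c) \<in> ?\<pi>"
    proof
      fix c
      \<comment> \<open>\<open>z 0\<close> is the bound variable for the point to be hit; it differs
        from every \<open>y b\<close>, so the encoded similarity is unchanged.\<close>
      show "\<exists>b. (b, c) \<in> ?\<pi>" using L[rule_format, of "s(z 0 := c)"] y_z by (simp add: decoded_def)
    qed
  next
    assume R: "\<forall>c. \<exists>b. (b, c) \<in> ?\<pi>"
    show ?surj
    proof (intro allI impI)
      fix t :: "'v \<Rightarrow> 'a" assume "\<forall>v. v \<notin> {z 0} \<longrightarrow> t v = s v"
      then show "\<exists>b\<in>UNIV. (t (y b), t (z 0)) \<in> simeq TYPE('v) q" using R y_z by (simp add: decoded_def)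
    qed
  qed
  have img: "map (\<lambda>i. image_rel \<pi> (Rs ! i)) [0..<length ls] \<in> rels_of_type ls"
    if "Rs \<in> rels_of_type ls" for Rs ls and \<pi> :: "('a \<times> 'a) set"
    using that by (simp add: rels_of_type_def image_rel_tuples)
  have self: "tup_rel ?\<pi> bs (map s (map y bs))" for bs
    by (auto simp: tup_rel_iff_nth decoded_def simeq_refl)
  show ?thesis
  proof (intro iffI conjI)
    assume \<pi>: "?\<pi> \<in> Sim TYPE('v) q"
    note comp = compatible_simeq[OF infinite_vars \<pi>]
    note sim = Sim_similarity[OF \<pi>]
    show ?surj unfolding surj using similarity_left[OF sim] by blast
    have "(b, s (y b)) \<in> ?\<pi>" for b by (simp add: decoded_def simeq_refl)
    then show ?comp using comp unfolding compatible_def by blast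
    show ?rels
    proof (intro ballI)
      fix p and bs :: "'a list" assume "p \<in> {p. Rel (fst p) (snd p) \<in> q}" "bs \<in> tuples (fst p)"
      then have "Rel (fst p) (snd p) \<in> q" "length bs = fst p" by (simp_all add: tuples_def)
      from rel_invD[OF Sim_rel[OF \<pi> this(1)] this(2) self]
      show "map s (map y bs) \<in> snd p \<longleftrightarrow> bs \<in> snd p" by (rule sym)
    qed
    show ?quants
    proof (intro ballI)
      fix p Rs assume p: "p \<in> {p. Quant (fst p) (snd p) \<in> q}" and
        Rs: "Rs \<in> {Rs \<in> rels_of_type (fst p). \<forall>i<length (fst p). rel_inv (simeq TYPE('v) q) (fst p ! i) (Rs ! i)}"
      have "Rs \<in> snd p \<longleftrightarrow> map (\<lambda>i. image_rel ?\<pi> (Rs ! i)) [0..<length (fst p)] \<in> snd p"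
      proof (rule quant_invD[OF Sim_quant[OF \<pi>]])
        show s: "\<forall>i<length (fst p). sim_rel ?\<pi> (fst p ! i) (Rs ! i)
            (map (\<lambda>i. image_rel ?\<pi> (Rs ! i)) [0..<length (fst p)] ! i)"
          using Rs sim_rel_image_rel[OF comp refl_simeq] by simp
        show "\<forall>i<length (fst p). rel_inv (simeq TYPE('v) q) (fst p ! i)
            (map (\<lambda>i. image_rel ?\<pi> (Rs ! i)) [0..<length (fst p)] ! i)"
          using Rs s rel_inv_sim_rel[OF comp sim] by blast
      qed (use p Rs img in auto)
      then show "map (\<lambda>i. image_rel ?\<pi> (Rs ! i)) [0..<length (fst p)] \<in> snd p \<longleftrightarrow> Rs \<in> snd p" by blast
    qed
  next
    assume A: "?surj \<and> ?comp \<and> ?rels \<and> ?quants"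
    note rels = A[THEN conjunct2, THEN conjunct2, THEN conjunct1]
    note quants = A[THEN conjunct2, THEN conjunct2, THEN conjunct2]
    have "\<forall>c. \<exists>b. (b, c) \<in> ?\<pi>" using A[THEN conjunct1] surj by (rule iffD1[rotated])
    moreover have "(b, s (y b)) \<in> ?\<pi>" for b by (simp add: decoded_def simeq_refl)
    ultimately have sim: "similarity ?\<pi>" unfolding similarity_def by blast
    show "?\<pi> \<in> Sim TYPE('v) q"
    proof (rule SimI)
      fix k R assume R: "Rel k R \<in> q"
      show "rel_inv ?\<pi> k R"
        unfolding rel_inv_def sim_rel_def
      proof (intro allI impI)
        fix as bs assume k: "length as = k" and t: "tup_rel ?\<pi> as bs"
        have "tup_rel (simeq TYPE('v) q) (map s (map y as)) bs" using t by (auto simp: tup_rel_iff_nth decoded_def)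
        then have "map s (map y as) \<in> R \<longleftrightarrow> bs \<in> R"
          using rel_invD[OF rel_inv_simeq[OF infinite_vars R], of "map s (map y as)"] k by simp
        moreover have "map s (map y as) \<in> snd (k, R) \<longleftrightarrow> as \<in> snd (k, R)"
          by (rule bspec[OF bspec[OF rels]]) (simp_all add: R k tuples_def)
        ultimately show "as \<in> R \<longleftrightarrow> bs \<in> R" by simp
      qed
    next
      fix ks Q assume Q: "Quant ks Q \<in> q"
      show "quant_inv (simeq TYPE('v) q) ?\<pi> ks Q"
      proof (rule quant_invI)
        fix Rs Ss assume *: "Rs \<in> rels_of_type ks" "Ss \<in> rels_of_type ks"
          "\<forall>i<length ks. rel_inv (simeq TYPE('v) q) (ks ! i) (Rs ! i)"
          "\<forall>i<length ks. sim_rel ?\<pi> (ks ! i) (Rs ! i) (Ss ! i)"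
        have "Ss = map (\<lambda>i. image_rel ?\<pi> (Rs ! i)) [0..<length ks]"
        proof (rule nth_equalityI)
          fix i assume "i < length Ss"
          then have i: "i < length ks" using * by (simp add: rels_of_type_def)
          then have "Ss ! i = image_rel ?\<pi> (Rs ! i)"
            using * by (intro sim_rel_imp_image_rel[OF sim, of "ks ! i"]) (auto simp: rels_of_type_def)
          then show "Ss ! i = map (\<lambda>i. image_rel ?\<pi> (Rs ! i)) [0..<length ks] ! i" using i by simp
        qed (use * in \<open>simp add: rels_of_type_def\<close>)
        moreover have "map (\<lambda>i. image_rel ?\<pi> (Rs ! i)) [0..<length (fst (ks, Q))] \<in> snd (ks, Q) \<longleftrightarrow>
            Rs \<in> snd (ks, Q)"
          by (rule bspec[OF bspec[OF quants]]) (simp_all add: Q *)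
        ultimately show "Rs \<in> Q \<longleftrightarrow> Ss \<in> Q" by simp
      qed
    qed (rule sim)
  qed
qed

lemma fmlx_decoded_in_Sim:
  "(\<lambda>P. {s :: 'v \<Rightarrow> 'a. decoded q y s \<in> Sim TYPE('v) q}) \<in> fmlx q ks"
  unfolding decoded_in_Sim_iff
proof (rule fmlx_and[OF _ fmlx_and[OF _ fmlx_and]])
  show "(\<lambda>P. {s :: 'v \<Rightarrow> 'a. \<forall>t. (\<forall>v. v \<notin> {z 0} \<longrightarrow> t v = s v) \<longrightarrow> (\<exists>b\<in>UNIV. (t (y b), t (z 0)) \<in> simeq TYPE('v) q)})
      \<in> fmlx q ks"
    by (rule fmlx_all_var, rule fmlx_ex, rule fmlx_simeq[OF infinite_vars])
  show "(\<lambda>P. {s :: 'v \<Rightarrow> 'a. \<forall>b\<in>UNIV. \<forall>b'\<in>UNIV. (s (y b), s (y b')) \<in> simeq TYPE('v) q \<longleftrightarrow> (b, b') \<in> simeq TYPE('v) q}) \<in> fmlx q ks"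
    by (rule fmlx_all, rule fmlx_all, rule fmlx_iff, rule fmlx_simeq[OF infinite_vars], rule fmlx_const)
  show "(\<lambda>P. {s :: 'v \<Rightarrow> 'a. \<forall>p\<in>{p. Rel (fst p) (snd p) \<in> q}. \<forall>bs\<in>tuples (fst p).
        map s (map y bs) \<in> snd p \<longleftrightarrow> bs \<in> snd p}) \<in> fmlx q ks"
    by (rule fmlx_all, rule fmlx_all, rule fmlx_iff[OF fmlx.atom fmlx_const]) (auto simp: tuples_def)
  show "(\<lambda>P. {s :: 'v \<Rightarrow> 'a. \<forall>p\<in>{p. Quant (fst p) (snd p) \<in> q}.
        \<forall>Rs\<in>{Rs \<in> rels_of_type (fst p). \<forall>i<length (fst p). rel_inv (simeq TYPE('v) q) (fst p ! i) (Rs ! i)}.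
        map (\<lambda>i. image_rel (decoded q y s) (Rs ! i)) [0..<length (fst p)] \<in> snd p \<longleftrightarrow> Rs \<in> snd p})
      \<in> fmlx q ks"
    by (rule fmlx_all, rule fmlx_all, rule fmlx_iff[OF fmlx_quant_image_rel fmlx_const]) auto
qed

text \<open>The defining formula quantifies away all variables except the arguments and asks for an
  encoded similarity in \<open>Sim q\<close> that maps some member of \<open>R\<close> to them.
  Invariance of \<open>R\<close> gives one inclusion, the encoding of \<open>simeq\<close> the
  other.\<close>

lemma definable_relI:
  assumes R: "R \<subseteq> tuples k" and inv: "\<forall>\<pi>\<in>Sim TYPE('v) q. rel_inv \<pi> k R"
  shows "definable_rel TYPE('v) q k R"
proof -
  let ?S = "{s :: 'v \<Rightarrow> 'a. \<exists>t. (\<forall>v. v \<notin> - set (zs k) \<longrightarrow> t v = s v) \<and>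
    decoded q y t \<in> Sim TYPE('v) q \<and> map t (zs k) \<in> image_rel (decoded q y t) R}"
  have "(\<lambda>P. ?S) \<in> fmlx q []"
    by (rule fmlx_ex_var, rule fmlx_and, rule fmlx_decoded_in_Sim, rule fmlx_image_rel)
  then have "?S \<in> fml q" unfolding fml_def by (rule rev_image_eqI) simp
  moreover have "depends_only ?S (set (zs k))" by (rule depends_only_ex)
  moreover have "R = rel_of ?S s (zs k)" for s
  proof -
    have "as \<in> R \<longleftrightarrow> upds s (zs k) as \<in> ?S" if k: "length as = k" for as
    proof
      assume as: "as \<in> R"
      \<comment> \<open>This keeps the arguments \<open>as\<close> and encodes \<open>simeq\<close>
        in the remaining variables.\<close>
      let ?t = "upds (inv y) (zs k) as"
      have dec: "decoded q y ?t = simeq TYPE('v) q" by (simp add: decoded_upds decoded_inv del: map_map)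
      have "map ?t (zs k) = map (upds s (zs k) as) (zs k)" using k by (simp add: map_upds_zs del: map_map)
      then have "\<forall>v. v \<notin> - set (zs k) \<longrightarrow> ?t v = upds s (zs k) as v"
        by (simp only: map_eq_conv Compl_iff not_not Ball_def)
      moreover have "as \<in> image_rel (simeq TYPE('v) q) R"
        using as by (auto simp: image_rel_def intro!: bexI[of _ as] tup_rel_refl simeq_refl)
      ultimately show "upds s (zs k) as \<in> ?S"
        using simeq_in_Sim[OF infinite_vars, of q] k
        by (intro CollectI exI[of _ ?t]) (simp add: dec map_upds_zs del: map_map)
    next
      assume "upds s (zs k) as \<in> ?S"
      then obtain t where t: "\<forall>v. v \<notin> - set (zs k) \<longrightarrow> t v = upds s (zs k) as v"
        "decoded q y t \<in> Sim TYPE('v) q" "map t (zs k) \<in> image_rel (decoded q y t) R" by blast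
      have "map t (zs k) = map (upds s (zs k) as) (zs k)" using t(1) by (simp only: map_eq_conv Compl_iff not_not Ball_def)
      then have "as \<in> image_rel (decoded q y t) R" using t(3) k by (simp add: map_upds_zs del: map_map)
      then show "as \<in> R" using inv t(2) R rel_invD by (fastforce simp: image_rel_def tuples_def)
    qed
    then show ?thesis using R by (auto simp: rel_of_def tuples_def simp del: map_map)
  qed
  ultimately show ?thesis
    unfolding definable_rel_def using distinct_zs[of k] by (intro bexI[of _ ?S] exI[of _ "zs k"]) simp_all
qed

lemma definable_relD:
  assumes "definable_rel TYPE('v) q k R" and \<pi>: "\<pi> \<in> Sim TYPE('v) q"
  shows "rel_inv \<pi> k R"
  unfolding rel_inv_def sim_rel_def
proof (intro allI impI)
  fix as bs assume k: "length as = k" and ab: "tup_rel \<pi> as bs"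
  obtain S :: "('v \<Rightarrow> 'a) set" and vs where S: "S \<in> fml q" "length vs = k" "\<And>s. R = rel_of S s vs"
    using assms(1) unfolding definable_rel_def by blast
  \<comment> \<open>The values outside \<open>vs\<close> do not affect \<open>R\<close>, but the two
    assignments must be related everywhere, so related constants are used there.\<close>
  obtain a b where p: "(a, b) \<in> \<pi>" using similarity_right[OF Sim_similarity[OF \<pi>]] by blast
  have "\<forall>v. (upds (\<lambda>_. a) vs as v, upds (\<lambda>_. b) vs bs v) \<in> \<pi>"
    by (rule allI, rule upds_rel[OF ab]) (simp add: p)
  then have "upds (\<lambda>_. a) vs as \<in> S \<longleftrightarrow> upds (\<lambda>_. b) vs bs \<in> S"
    by (rule fml_Sim_inv[OF infinite_vars S(1) \<pi>])
  then have "as \<in> rel_of S (\<lambda>_. a) vs \<longleftrightarrow> bs \<in> rel_of S (\<lambda>_. b) vs"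
    using k S(2) tup_rel_length[OF ab] by (simp add: rel_of_def)
  then show "as \<in> R \<longleftrightarrow> bs \<in> R" using S(3) by metis
qed

text \<open>With parameters, \<open>inv y\<close> names every element, so the image of
  \<open>R\<close> under \<open>simeq\<close> is definable, and for an invariant \<open>R\<close>
  this is \<open>R\<close> itself.\<close>

lemma definable_rel_param_iff:
  assumes R: "R \<subseteq> tuples k"
  shows "definable_rel_param TYPE('v) q k R \<longleftrightarrow> rel_inv (simeq TYPE('v) q) k R"
proof
  assume "definable_rel_param TYPE('v) q k R"
  then obtain S :: "('v \<Rightarrow> 'a) set" and vs s where S: "S \<in> fml q" "length vs = k" "R = rel_of S s vs"
    unfolding definable_rel_param_def by blast
  show "rel_inv (simeq TYPE('v) q) k R"
    unfolding rel_inv_def sim_rel_def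
  proof (intro allI impI)
    fix as bs assume k: "length as = k" and ab: "tup_rel (simeq TYPE('v) q) as bs"
    have "\<forall>v. (upds s vs as v, upds s vs bs v) \<in> simeq TYPE('v) q" 
      by (rule allI, rule upds_rel[OF ab]) (simp add: simeq_refl)
    then have "upds s vs as \<in> S \<longleftrightarrow> upds s vs bs \<in> S"
      by (rule fml_Sim_inv[OF infinite_vars S(1) simeq_in_Sim[OF infinite_vars]])
    then show "as \<in> R \<longleftrightarrow> bs \<in> R" using k S(2,3) tup_rel_length[OF ab] by (simp add: rel_of_def)
  qed
next
  assume inv: "rel_inv (simeq TYPE('v) q) k R"
  let ?S = "{s :: 'v \<Rightarrow> 'a. map s (zs k) \<in> image_rel (decoded q y s) R}"
  have "?S \<in> fml q" using fmlx_image_rel[of "zs k" R "[]"] unfolding fml_def by (rule rev_image_eqI) simp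
  moreover have "R = rel_of ?S (inv y) (zs k)"
    using sim_rel_imp_image_rel[OF Sim_similarity[OF simeq_in_Sim[OF infinite_vars]] inv[unfolded rel_inv_def] R R]
    by (simp only: rel_of_image_rel[OF R] decoded_inv)
  ultimately show "definable_rel_param TYPE('v) q k R"
    unfolding definable_rel_param_def using distinct_zs[of k]
    by (intro bexI[of _ ?S] exI[of _ "zs k"] exI[of _ "inv y"]) simp_all
qed

section \<open>Definability of quantifiers\<close>

lemma restrict_quant_eq:
  assumes "Q \<subseteq> rels_of_type ks"
  shows "restrict_quant TYPE('v) q ks Q = {Rs\<in>Q. \<forall>i<length ks. rel_inv (simeq TYPE('v) q) (ks ! i) (Rs ! i)}"
  unfolding restrict_quant_def
proof (rule Collect_cong, rule conj_cong[OF refl])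
  fix Rs assume "Rs \<in> Q"
  then have "definable_rel_param TYPE('v) q (ks ! i) (Rs ! i) \<longleftrightarrow> rel_inv (simeq TYPE('v) q) (ks ! i) (Rs ! i)"
    if "i < length ks" for i
    using assms that by (intro definable_rel_param_iff) (auto simp: rels_of_type_def)
  then show "(\<forall>i<length ks. definable_rel_param TYPE('v) q (ks ! i) (Rs ! i)) \<longleftrightarrow>
      (\<forall>i<length ks. rel_inv (simeq TYPE('v) q) (ks ! i) (Rs ! i))" by blast
qed

text \<open>Equality of a new predicate with an encoded image is expressed by universally
  quantifying the argument variables.\<close>

lemma all_image_rel_iff:
  assumes "A \<subseteq> tuples k" "R \<subseteq> tuples k"
  shows "(\<forall>u. (\<forall>v. v \<notin> set (zs k) \<longrightarrow> u v = t v) \<longrightarrow>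
      (map u (zs k) \<in> A \<longleftrightarrow> map u (zs k) \<in> image_rel (decoded q y u) R)) \<longleftrightarrow>
     A = image_rel (decoded q y t) R" (is "?L \<longleftrightarrow> ?R")
proof
  assume L: ?L
  have *: "as \<in> A \<longleftrightarrow> as \<in> image_rel (decoded q y t) R" if k: "length as = k" for as
  proof -
    have "\<forall>v. v \<notin> set (zs k) \<longrightarrow> upds t (zs k) as v = t v"
      by (intro allI impI upds_notin)
    from L[THEN spec, THEN mp, OF this] show ?thesis
      using k by (simp add: map_upds_zs decoded_upds del: map_map set_map)
  qed
  show ?R
  proof (rule set_eqI)
    fix as
    show "as \<in> A \<longleftrightarrow> as \<in> image_rel (decoded q y t) R"
      using * assms(1) image_rel_tuples[OF assms(2), of "decoded q y t"]
      by (cases "length as = k") (auto simp: tuples_def)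
  qed
next
  assume R: ?R
  show ?L
  proof (intro allI impI)
    fix u assume u: "\<forall>v. v \<notin> set (zs k) \<longrightarrow> u v = t v"
    have "decoded q y u = decoded q y t" using u[THEN spec, THEN mp, OF y_zs] by (rule decoded_cong)
    then show "map u (zs k) \<in> A \<longleftrightarrow> map u (zs k) \<in> image_rel (decoded q y u) R"
      unfolding R by (simp del: map_map)
  qed
qed

lemma definable_quantI:
  assumes Q: "Q \<subseteq> rels_of_type ks" and inv: "\<forall>\<pi>\<in>Sim TYPE('v) q. quant_inv (simeq TYPE('v) q) \<pi> ks Q"
  shows "definable_quant TYPE('v) q ks (restrict_quant TYPE('v) q ks Q)"
proof -
  let ?Q = "{Rs\<in>Q. \<forall>i<length ks. rel_inv (simeq TYPE('v) q) (ks ! i) (Rs ! i)}"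
  \<comment> \<open>Quantifying over \<open>UNIV\<close> binds all variables, which makes this a
    sentence: its value is \<open>{}\<close> or \<open>UNIV\<close>.\<close>
  let ?f = "\<lambda>P. {s :: 'v \<Rightarrow> 'a. \<exists>t. (\<forall>v. v \<notin> UNIV \<longrightarrow> t v = s v) \<and> (decoded q y t \<in> Sim TYPE('v) q \<and>
    (\<exists>Rs\<in>?Q. \<forall>i\<in>{..<length ks}. \<forall>u. (\<forall>v. v \<notin> set (zs (ks ! i)) \<longrightarrow> u v = t v) \<longrightarrow>
      (map u (zs (ks ! i)) \<in> P ! i \<longleftrightarrow> map u (zs (ks ! i)) \<in> image_rel (decoded q y u) (Rs ! i))))}"
  have f_fmlx: "?f \<in> fmlx q ks"
    by (rule fmlx_ex_var, rule fmlx_and, rule fmlx_decoded_in_Sim, rule fmlx_ex, rule fmlx_all,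
        rule fmlx_all_var, rule fmlx_iff, rule fmlx.newatom, simp, simp, rule fmlx_image_rel)
  have f_defines: "(?f P = {} \<or> ?f P = UNIV) \<and> (P \<in> ?Q \<longleftrightarrow> ?f P = UNIV)" if P: "P \<in> rels_of_type ks" for P
  proof -
    define \<phi> where "\<phi> \<longleftrightarrow> (\<exists>t. decoded q y t \<in> Sim TYPE('v) q \<and>
      (\<exists>Rs\<in>?Q. \<forall>i<length ks. P ! i = image_rel (decoded q y t) (Rs ! i)))"
    have "(\<forall>i\<in>{..<length ks}. \<forall>u. (\<forall>v. v \<notin> set (zs (ks ! i)) \<longrightarrow> u v = t v) \<longrightarrow>
      (map u (zs (ks ! i)) \<in> P ! i \<longleftrightarrow> map u (zs (ks ! i)) \<in> image_rel (decoded q y u) (Rs ! i))) \<longleftrightarrow>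
      (\<forall>i<length ks. P ! i = image_rel (decoded q y t) (Rs ! i))" if "Rs \<in> ?Q" for t Rs
    proof -
      have "P ! i \<subseteq> tuples (ks ! i)" "Rs ! i \<subseteq> tuples (ks ! i)" if "i < length ks" for i
        using P Q \<open>Rs \<in> ?Q\<close> that by (auto simp: rels_of_type_def)
      then show ?thesis by (simp only: all_image_rel_iff lessThan_iff Ball_def cong: imp_cong)
    qed
    then have f: "?f P = {s. \<phi>}" unfolding \<phi>_def by (simp del: map_map set_map mem_Collect_eq)
    have "P \<in> ?Q \<longleftrightarrow> \<phi>"
    proof
      assume PQ: "P \<in> ?Q"
      have "P ! i = image_rel (simeq TYPE('v) q) (P ! i)" if i: "i < length ks" for i
        using P PQ i by (intro sim_rel_imp_image_rel[OF Sim_similarity[OF simeq_in_Sim[OF infinite_vars]], where k = "ks ! i"])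
          (auto simp: rels_of_type_def rel_inv_def)
      then show \<phi> unfolding \<phi>_def using PQ simeq_in_Sim[OF infinite_vars, of q]
        by (intro exI[of _ "inv y"] conjI bexI[of _ P]) (simp_all add: decoded_inv)
    next
      assume \<phi>
      then obtain t Rs where t: "decoded q y t \<in> Sim TYPE('v) q" and Rs: "Rs \<in> ?Q"
        and PR: "\<And>i. i < length ks \<Longrightarrow> P ! i = image_rel (decoded q y t) (Rs ! i)"
        unfolding \<phi>_def by blast
      note comp = compatible_simeq[OF infinite_vars t]
      have s: "\<forall>i<length ks. sim_rel (decoded q y t) (ks ! i) (Rs ! i) (P ! i)"
        using Rs PR sim_rel_image_rel[OF comp refl_simeq] by simp
      then have i: "\<forall>i<length ks. rel_inv (simeq TYPE('v) q) (ks ! i) (P ! i)"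
        using Rs rel_inv_sim_rel[OF comp Sim_similarity[OF t]] by blast
      have "Rs \<in> Q \<longleftrightarrow> P \<in> Q" using inv t Rs Q by (intro quant_invD[OF _ _ P _ i s]) auto
      then show "P \<in> ?Q" using Rs i by blast
    qed
    then show ?thesis unfolding f by (cases \<phi>) auto
  qed
  show ?thesis
    unfolding definable_quant_def restrict_quant_eq[OF Q]
    by (rule bexI[OF ballI f_fmlx], rule f_defines)
qed

lemma definable_quantD:
  assumes Q: "Q \<subseteq> rels_of_type ks" and \<pi>: "\<pi> \<in> Sim TYPE('v) q"
    and "definable_quant TYPE('v) q ks (restrict_quant TYPE('v) q ks Q)"
  shows "quant_inv (simeq TYPE('v) q) \<pi> ks Q"
proof (rule quant_invI)
  obtain f :: "'a list set list \<Rightarrow> ('v \<Rightarrow> 'a) set" where f: "f \<in> fmlx q ks"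
    "\<And>Rs. Rs \<in> rels_of_type ks \<Longrightarrow> f Rs = {} \<or> f Rs = UNIV"
    "\<And>Rs. Rs \<in> rels_of_type ks \<Longrightarrow> Rs \<in> Q \<and> (\<forall>i<length ks. rel_inv (simeq TYPE('v) q) (ks ! i) (Rs ! i)) \<longleftrightarrow> f Rs = UNIV"
    using assms(3) unfolding definable_quant_def restrict_quant_eq[OF Q] by auto
  fix Rs Ss assume *: "Rs \<in> rels_of_type ks" "Ss \<in> rels_of_type ks"
    "\<forall>i<length ks. rel_inv (simeq TYPE('v) q) (ks ! i) (Rs ! i)" "\<forall>i<length ks. rel_inv (simeq TYPE('v) q) (ks ! i) (Ss ! i)"
    "\<forall>i<length ks. sim_rel \<pi> (ks ! i) (Rs ! i) (Ss ! i)"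
  obtain a b where ab: "(a, b) \<in> \<pi>" using similarity_right[OF Sim_similarity[OF \<pi>]] by blast
  \<comment> \<open>A sentence is decided by any single assignment, so one related pair of constant
    assignments suffices.\<close>
  have "(\<lambda>_. a) \<in> f Rs \<longleftrightarrow> (\<lambda>_. b) \<in> f Ss"
    using ab by (intro fmlx_Sim_inv[OF infinite_vars f(1) \<pi> *(3-5)]) simp
  then have "f Rs = UNIV \<longleftrightarrow> f Ss = UNIV" using f(2)[OF *(1)] f(2)[OF *(2)] by auto
  then show "Rs \<in> Q \<longleftrightarrow> Ss \<in> Q" using f(3)[OF *(1)] f(3)[OF *(2)] *(3,4) by blast
qed

end

section \<open>Full monoids of similarities\<close>

lemma full_monoid_Sim:
  fixes q :: "'a oper set"
  assumes inf: "infinite (UNIV :: 'v set)"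
  shows "full_monoid (Sim TYPE('v) q)"
proof -
  let ?E = "simeq TYPE('v) q"
  have "\<pi> O \<rho> \<in> Sim TYPE('v) q" if \<pi>: "\<pi> \<in> Sim TYPE('v) q" and \<rho>: "\<rho> \<in> Sim TYPE('v) q" for \<pi> \<rho>
  proof (rule SimI)
    show "similarity (\<pi> O \<rho>)" by (intro similarity_relcomp Sim_similarity[OF \<pi>] Sim_similarity[OF \<rho>])
    show "rel_inv (\<pi> O \<rho>) k R" if "Rel k R \<in> q" for k R
      using Sim_rel[OF \<pi> that] Sim_rel[OF \<rho> that] unfolding rel_inv_def by (rule sim_rel_relcompI)
    fix ks Q assume Qq: "Quant ks Q \<in> q"
    note comp = compatible_simeq[OF inf \<pi>]
    show "quant_inv ?E (\<pi> O \<rho>) ks Q"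
    proof (rule quant_invI)
      fix Rs Ss assume *: "Rs \<in> rels_of_type ks" "Ss \<in> rels_of_type ks"
        "\<forall>i<length ks. rel_inv ?E (ks ! i) (Rs ! i)" "\<forall>i<length ks. rel_inv ?E (ks ! i) (Ss ! i)"
        "\<forall>i<length ks. sim_rel (\<pi> O \<rho>) (ks ! i) (Rs ! i) (Ss ! i)"
      \<comment> \<open>Invariance under a composition needs an intermediate tuple of relations. The
        \<open>\<pi>\<close>-image of \<open>Rs\<close> serves, being again
        \<open>simeq\<close>-invariant and so visible to \<open>quant_inv\<close> for
        \<open>\<rho>\<close>.\<close>
      define Ts where "Ts = map (\<lambda>i. image_rel \<pi> (Rs ! i)) [0..<length ks]"
      have Ts: "Ts \<in> rels_of_type ks"
        using *(1) by (simp add: rels_of_type_def Ts_def image_rel_tuples)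
      have RT: "\<forall>i<length ks. sim_rel \<pi> (ks ! i) (Rs ! i) (Ts ! i)"
        using *(3) sim_rel_image_rel[OF comp refl_simeq] by (simp add: Ts_def)
      have T: "\<forall>i<length ks. rel_inv ?E (ks ! i) (Ts ! i)"
        using *(3) RT rel_inv_sim_rel[OF comp Sim_similarity[OF \<pi>]] by blast
      have TS: "\<forall>i<length ks. sim_rel \<rho> (ks ! i) (Ts ! i) (Ss ! i)"
        unfolding sim_rel_def
      proof (intro allI impI)
        fix i bs cs assume i: "i < length ks" and k: "length bs = ks ! i" and bc: "tup_rel \<rho> bs cs"
        obtain as where ab: "tup_rel \<pi> as bs" by (rule similarity_tup_left[OF Sim_similarity[OF \<pi>]])
        then have k': "length as = ks ! i" using k by (simp add: tup_rel_length)
        have "tup_rel (\<pi> O \<rho>) as cs" using ab bc tup_rel_relcomp by blast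
        then show "bs \<in> Ts ! i \<longleftrightarrow> cs \<in> Ss ! i"
          using sim_relD[OF RT[rule_format, OF i] k' ab] sim_relD[OF *(5)[rule_format, OF i] k'] by blast
      qed
      show "Rs \<in> Q \<longleftrightarrow> Ss \<in> Q"
        using quant_invD[OF Sim_quant[OF \<pi> Qq] *(1) Ts *(3) T RT]
          quant_invD[OF Sim_quant[OF \<rho> Qq] Ts *(2) T *(4) TS] by blast
    qed
  qed
  moreover have "\<pi>\<inverse> \<in> Sim TYPE('v) q" if \<pi>: "\<pi> \<in> Sim TYPE('v) q" for \<pi>
  proof (rule SimI)
    show "similarity (\<pi>\<inverse>)" by (rule similarity_converse[OF Sim_similarity[OF \<pi>]])
    show "rel_inv (\<pi>\<inverse>) k R" if "Rel k R \<in> q" for k R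
      using Sim_rel[OF \<pi> that] unfolding rel_inv_def sim_rel_converse .
    show "quant_inv ?E (\<pi>\<inverse>) ks Q" if "Quant ks Q \<in> q" for ks Q
      using Sim_quant[OF \<pi> that] unfolding quant_inv_def sim_rel_converse by blast
  qed
  moreover have "approx (Sim TYPE('v) q) \<in> Sim TYPE('v) q"
    by (simp add: approx_Sim[OF inf] simeq_in_Sim[OF inf])
  moreover have "\<pi>' \<in> Sim TYPE('v) q"
    if \<pi>: "\<pi> \<in> Sim TYPE('v) q" and sub: "\<pi>' \<subseteq> \<pi>" "similarity \<pi>'" for \<pi> \<pi>'
  proof (rule SimI)
    show "rel_inv \<pi>' k R" if "Rel k R \<in> q" for k R
      using Sim_rel[OF \<pi> that] sub(1) by (rule rel_inv_antimono[rotated])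
    show "quant_inv ?E \<pi>' ks Q" if "Quant ks Q \<in> q" for ks Q
    proof (rule quant_invI)
      fix Rs Ss assume *: "Rs \<in> rels_of_type ks" "Ss \<in> rels_of_type ks"
        "\<forall>i<length ks. rel_inv ?E (ks ! i) (Rs ! i)" "\<forall>i<length ks. rel_inv ?E (ks ! i) (Ss ! i)"
        "\<forall>i<length ks. sim_rel \<pi>' (ks ! i) (Rs ! i) (Ss ! i)"
      have "\<forall>i<length ks. sim_rel \<pi> (ks ! i) (Rs ! i) (Ss ! i)"
        using *(3,5) sim_rel_subset[OF compatible_simeq[OF inf \<pi>] refl_simeq sub] by blast
      then show "Rs \<in> Q \<longleftrightarrow> Ss \<in> Q"
        by (rule quant_invD[OF Sim_quant[OF \<pi> that] *(1-4)])
    qed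
  qed (rule sub(2))
  ultimately show ?thesis unfolding full_monoid_def monoid_inv_def by blast
qed

section \<open>Formulas over the invariants of a set of similarities\<close>

lemma Rel_in_Inv_iff: "Rel k R \<in> Inv \<Pi> \<longleftrightarrow> R \<subseteq> tuples k \<and> (\<forall>\<pi>\<in>\<Pi>. rel_inv \<pi> k R)"
  by (auto simp: Inv_def)

lemma Quant_in_Inv_iff:
  "Quant ks Q \<in> Inv \<Pi> \<longleftrightarrow> Q \<subseteq> rels_of_type ks \<and> (\<forall>\<pi>\<in>\<Pi>. quant_inv (approx \<Pi>) \<pi> ks Q)"
  by (auto simp: Inv_def)

lemma approx_subset_simeq: "approx \<Pi> \<subseteq> simeq TYPE('v) (Inv \<Pi>)"
proof
  fix p assume p: "p \<in> approx \<Pi>"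
  obtain a b where ab: "p = (a, b)" by (cases p)
  \<comment> \<open>For arbitrary \<open>\<Pi>\<close> the relation \<open>approx \<Pi>\<close> need
    not be reflexive, so \<open>Id\<close> is added to meet the premise of
    \<open>fmlx_rel_inv\<close>.\<close>
  have rels: "rel_inv (approx \<Pi> \<union> Id) k R" if "Rel k R \<in> Inv \<Pi>" for k R
  proof (rule rel_inv_coordinatewise)
    fix a b :: 'a and as bs :: "'a list"
    assume "(a, b) \<in> approx \<Pi> \<union> Id" and k: "length as + length bs + 1 = k"
    then consider "a = b" | "(a, b) \<in> approx \<Pi>" by blast
    then show "as @ a # bs \<in> R \<longleftrightarrow> as @ b # bs \<in> R"
    proof cases
      case 2
      \<comment> \<open>The other entries of the tuple serve as the finite parameter list in
        \<open>approx\<close>.\<close>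
      then obtain \<pi> where \<pi>: "\<pi> \<in> \<Pi>" "tup_rel \<pi> (a # as @ bs) (b # as @ bs)"
        unfolding approx_def by blast
      have "tup_rel \<pi> (as @ a # bs) (as @ b # bs)"
        using \<pi>(2) by (auto simp: tup_rel_def list_all2_append)
      moreover have "rel_inv \<pi> k R" using that \<pi>(1) by (simp add: Rel_in_Inv_iff)
      ultimately show ?thesis using k by (intro rel_invD[of \<pi> k]) auto
    qed simp
  qed
  show "p \<in> simeq TYPE('v) (Inv \<Pi>)"
    unfolding ab simeq_def
  proof (intro CollectI case_prodI ballI allI)
    fix S :: "('v \<Rightarrow> 'a) set" and x s assume "S \<in> fml (Inv \<Pi>)"
    then obtain f :: "'a list set list \<Rightarrow> ('v \<Rightarrow> 'a) set" where f: "f \<in> fmlx (Inv \<Pi>) []" "S = f []"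
      unfolding fml_def by blast
    show "s(x := a) \<in> S \<longleftrightarrow> s(x := b) \<in> S"
      unfolding f(2) by (rule fmlx_rel_inv[OF f(1) _ rels]) (use p ab in auto)
  qed
qed

text \<open>\<open>Inv\<close> tests quantifiers on \<open>approx\<close>-invariant relations,
  \<open>Sim\<close> on \<open>simeq\<close>-invariant ones. The inclusion of the first congruence
  in the second makes the latter a subclass of the former.\<close>

lemma subset_Sim_Inv:
  assumes "\<forall>\<pi>\<in>\<Pi>. similarity \<pi>"
  shows "\<Pi> \<subseteq> Sim TYPE('v) (Inv \<Pi>)"
proof
  fix \<pi> assume \<pi>: "\<pi> \<in> \<Pi>"
  show "\<pi> \<in> Sim TYPE('v) (Inv \<Pi>)"
  proof (rule SimI)
    show "rel_inv \<pi> k R" if "Rel k R \<in> Inv \<Pi>" for k R using that \<pi> by (simp add: Rel_in_Inv_iff)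
    fix ks Q assume "Quant ks Q \<in> Inv \<Pi>"
    then have "quant_inv (approx \<Pi>) \<pi> ks Q" using \<pi> by (simp add: Quant_in_Inv_iff)
    then show "quant_inv (simeq TYPE('v) (Inv \<Pi>)) \<pi> ks Q"
      unfolding quant_inv_def using rel_inv_antimono[OF approx_subset_simeq] by blast
  qed (use assms \<pi> in blast)
qed

section \<open>Full monoids and their congruence\<close>

lemma full_monoid_relcomp: "full_monoid \<Sigma> \<Longrightarrow> \<pi> \<in> \<Sigma> \<Longrightarrow> \<rho> \<in> \<Sigma> \<Longrightarrow> \<pi> O \<rho> \<in> \<Sigma>"
  by (simp add: full_monoid_def monoid_inv_def)

lemma full_monoid_converse: "full_monoid \<Sigma> \<Longrightarrow> \<pi> \<in> \<Sigma> \<Longrightarrow> \<pi>\<inverse> \<in> \<Sigma>"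
  by (simp add: full_monoid_def monoid_inv_def)

lemma full_monoid_subset:
  "full_monoid \<Sigma> \<Longrightarrow> \<pi> \<in> \<Sigma> \<Longrightarrow> \<pi>' \<subseteq> \<pi> \<Longrightarrow> similarity \<pi>' \<Longrightarrow> \<pi>' \<in> \<Sigma>"
  by (simp add: full_monoid_def)

text \<open>Fullness makes \<open>\<Sigma>\<close> nonempty, and \<open>Id\<close> is a
  subsimilarity of \<open>\<pi> O \<pi>\<inverse>\<close> for any member.\<close>

lemma full_monoid_Id:
  assumes "\<forall>\<pi>\<in>\<Sigma>. similarity \<pi>" "full_monoid \<Sigma>"
  shows "Id \<in> \<Sigma>"
proof -
  obtain \<pi> where \<pi>: "\<pi> \<in> \<Sigma>" using assms(2) unfolding full_monoid_def by blast
  then have "\<pi> O \<pi>\<inverse> \<in> \<Sigma>" by (intro full_monoid_relcomp full_monoid_converse assms(2))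
  moreover have "Id \<subseteq> \<pi> O \<pi>\<inverse>" using similarity_right assms(1) \<pi> by fast
  moreover have "similarity (Id :: ('a \<times> 'a) set)" by (simp add: similarity_def)
  ultimately show ?thesis using assms(2) unfolding full_monoid_def by blast
qed

lemma equiv_approx:
  assumes "\<forall>\<pi>\<in>\<Sigma>. similarity \<pi>" "full_monoid \<Sigma>"
  shows "equiv UNIV (approx \<Sigma>)"
proof (rule equivI)
  show "refl (approx \<Sigma>)"
    using full_monoid_Id[OF assms] by (auto simp: refl_on_def approx_def intro!: bexI[of _ Id] tup_rel_refl)
  show "sym (approx \<Sigma>)"
  proof (rule symI)
    fix a b assume "(a, b) \<in> approx \<Sigma>"
    then have "\<exists>\<pi>\<in>\<Sigma>. tup_rel \<pi> (a # cs) (b # cs)" for cs by (simp add: approx_def)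
    moreover note full_monoid_converse[OF assms(2)]
    ultimately have "\<exists>\<pi>\<in>\<Sigma>. tup_rel \<pi> (b # cs) (a # cs)" for cs by (metis tup_rel_converse)
    then show "(b, a) \<in> approx \<Sigma>" by (simp add: approx_def)
  qed
  show "trans (approx \<Sigma>)"
  proof (rule transI)
    fix a b c assume "(a, b) \<in> approx \<Sigma>" "(b, c) \<in> approx \<Sigma>"
    then have "\<exists>\<pi>\<in>\<Sigma>. tup_rel \<pi> (a # cs) (b # cs)" "\<exists>\<pi>\<in>\<Sigma>. tup_rel \<pi> (b # cs) (c # cs)" for cs
      by (simp_all add: approx_def)
    moreover note full_monoid_relcomp[OF assms(2)]
    ultimately have "\<exists>\<pi>\<in>\<Sigma>. tup_rel \<pi> (a # cs) (c # cs)" for cs by (metis tup_rel_relcomp)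
    then show "(a, c) \<in> approx \<Sigma>" by (simp add: approx_def)
  qed
qed simp

text \<open>Parameters are pulled back along \<open>\<pi>\<close>, and the similarity found there is
  conjugated by \<open>\<pi>\<close>. The converse of \<open>\<pi>\<close> gives the other
  direction.\<close>

lemma compatible_approx:
  assumes sims: "\<forall>\<pi>\<in>\<Sigma>. similarity \<pi>" and full: "full_monoid \<Sigma>" and \<pi>: "\<pi> \<in> \<Sigma>"
  shows "compatible (approx \<Sigma>) \<pi>"
proof -
  have "(a', b') \<in> approx \<Sigma>"
    if ab: "(a, b) \<in> approx \<Sigma>" "(a, a') \<in> \<pi>" "(b, b') \<in> \<pi>" and \<pi>: "\<pi> \<in> \<Sigma>" for a a' b b' \<pi>
    unfolding approx_def
  proof (intro CollectI case_prodI allI)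
    fix cs' :: "'a list"
    obtain cs where cs: "tup_rel \<pi> cs cs'" using similarity_tup_left sims \<pi> by blast
    obtain \<rho> where \<rho>: "\<rho> \<in> \<Sigma>" "tup_rel \<rho> (a # cs) (b # cs)" using ab(1) by (auto simp: approx_def)
    have "tup_rel (\<pi>\<inverse>) (a' # cs') (a # cs)" using ab cs by (simp add: tup_rel_converse)
    moreover have "tup_rel \<pi> (b # cs) (b' # cs')" using ab cs by simp
    ultimately have "tup_rel (\<pi>\<inverse> O \<rho> O \<pi>) (a' # cs') (b' # cs')"
      using \<rho>(2) tup_rel_relcomp by blast
    moreover have "\<pi>\<inverse> O \<rho> O \<pi> \<in> \<Sigma>"
      by (intro full_monoid_relcomp full_monoid_converse full \<pi> \<rho>(1))
    ultimately show "\<exists>\<pi>\<in>\<Sigma>. tup_rel \<pi> (a' # cs') (b' # cs')" by blast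
  qed
  moreover note full_monoid_converse[OF full \<pi>]
  ultimately show ?thesis using \<pi> unfolding compatible_def by (meson converseI)
qed

section \<open>A rigid order of the classes and minimality\<close>

text \<open>A well-order of all subsets, made strict, is pulled back along the map sending an
  element to its class.\<close>

lemma ex_wf_class_order:
  fixes E :: "('a \<times> 'a) set"
  assumes E: "equiv UNIV E"
  obtains r where "wf r" "\<And>a b. (a, b) \<in> E \<or> (a, b) \<in> r \<or> (b, a) \<in> r"
    "\<And>a b a' b'. (a, a') \<in> E \<Longrightarrow> (b, b') \<in> E \<Longrightarrow> (a, b) \<in> r \<longleftrightarrow> (a', b') \<in> r"
proof -
  obtain w :: "('a set \<times> 'a set) set" where w: "well_order_on UNIV w" using well_order_on by blast
  define r where "r = inv_image (w - Id) (\<lambda>a. E `` {a})"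
  have total: "total w" using w by (simp add: well_order_on_def linear_order_on_def)
  have "wf r" using w unfolding r_def well_order_on_def by (intro wf_inv_image) blast
  moreover have "(a, b) \<in> E \<or> (a, b) \<in> r \<or> (b, a) \<in> r" for a b
  proof (cases "E `` {a} = E `` {b}")
    case True
    then show ?thesis using eq_equiv_class[OF _ E] by blast
  next
    case False
    then have "(E `` {a}, E `` {b}) \<in> w \<or> (E `` {b}, E `` {a}) \<in> w"
      using total by (simp add: total_on_def)
    then show ?thesis using False by (simp add: r_def)
  qed
  moreover have "(a, b) \<in> r \<longleftrightarrow> (a', b') \<in> r" if "(a, a') \<in> E" "(b, b') \<in> E" for a b a' b'
    using equiv_class_eq[OF E that(1)] equiv_class_eq[OF E that(2)] by (simp add: r_def)
  ultimately show thesis by (rule that)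
qed

text \<open>Well-orders are rigid, also up to the congruence \<open>E\<close>.\<close>

lemma wf_order_rigid:
  assumes E: "equiv UNIV E" and r: "wf r" "\<And>a b. (a, b) \<in> E \<or> (a, b) \<in> r \<or> (b, a) \<in> r"
    and cong: "\<And>a b a' b'. (a, a') \<in> E \<Longrightarrow> (b, b') \<in> E \<Longrightarrow> (a, b) \<in> r \<longleftrightarrow> (a', b') \<in> r"
    and \<tau>: "similarity \<tau>" "compatible r \<tau>"
    and "(a, b) \<in> \<tau>"
  shows "(a, b) \<in> E"
  using r(1) assms(7)
proof (induction a arbitrary: b rule: wf_induct_rule)
  case (less a)
  have refl: "(c, c) \<in> E" for c using E by (simp add: equiv_def refl_on_def)
  have irrefl: "(c, c) \<notin> r" for c using r(1) by (rule wf_not_refl)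
  consider "(a, b) \<in> E" | "(a, b) \<in> r" | "(b, a) \<in> r" using r(2) by blast
  then show ?case
  proof cases
    case 2
    \<comment> \<open>Pulling \<open>a\<close> back gives a smaller \<open>d\<close> related to
      \<open>a\<close> by \<open>\<tau>\<close>; the induction hypothesis makes \<open>d\<close> and
      \<open>a\<close> equivalent, contradicting irreflexivity. The remaining case pushes
      \<open>b\<close> forward instead.\<close>
    obtain d where d: "(d, a) \<in> \<tau>" using similarity_left[OF \<tau>(1)] by blast
    then have da: "(d, a) \<in> r" using \<tau>(2) less.prems 2 unfolding compatible_def by blast
    then have "(d, a) \<in> E" using less.IH d by blast
    then show ?thesis using cong[OF _ refl] da irrefl by blast
  next
    case 3
    obtain d where d: "(b, d) \<in> \<tau>" using similarity_right[OF \<tau>(1)] by blast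
    then have db: "(d, b) \<in> r" using \<tau>(2) less.prems 3 unfolding compatible_def by blast
    have "(b, d) \<in> E" using less.IH[OF 3 d] .
    then show ?thesis using cong[OF _ refl] db irrefl by blast
  qed
qed

definition pairs :: "('a \<times> 'a) set \<Rightarrow> 'a list set" where
  "pairs r = {[a, b] |a b. (a, b) \<in> r}"

lemma in_pairs_iff [simp]: "[a, b] \<in> pairs r \<longleftrightarrow> (a, b) \<in> r"
  by (simp add: pairs_def)

lemma pairs_tuples: "pairs r \<subseteq> tuples 2"
  by (auto simp: pairs_def tuples_def)

text \<open>This turns a congruence or an order into an operation, so that it can belong to
  \<open>Inv \<Pi>\<close>.\<close>

lemma rel_inv_pairs_iff:
  "rel_inv \<pi> 2 (pairs r) \<longleftrightarrow> compatible r \<pi>"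
proof
  assume inv: "rel_inv \<pi> 2 (pairs r)"
  show "compatible r \<pi>"
    unfolding compatible_def
  proof (intro allI impI)
    fix a a' b b' assume "(a, a') \<in> \<pi>" "(b, b') \<in> \<pi>"
    then show "(a, b) \<in> r \<longleftrightarrow> (a', b') \<in> r"
      using rel_invD[OF inv, of "[a, b]" "[a', b']"] by simp
  qed
next
  assume comp: "compatible r \<pi>"
  show "rel_inv \<pi> 2 (pairs r)"
    unfolding rel_inv_def sim_rel_def
  proof (intro allI impI)
    fix as bs assume "length as = 2" and ab: "tup_rel \<pi> as bs"
    then obtain a b where as: "as = [a, b]" by (auto simp: numeral_2_eq_2 length_Suc_conv)
    then obtain a' b' where bs: "bs = [a', b']"
      using tup_rel_length[OF ab, symmetric] by (auto simp: length_Suc_conv)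
    show "as \<in> pairs r \<longleftrightarrow> bs \<in> pairs r"
      using comp ab unfolding as bs compatible_def by simp
  qed
qed

text \<open>A similarity in \<open>Sim (Inv \<Pi>)\<close> preserves the congruence \<open>approx \<Sigma>\<close> and the quantifier
consisting of the \<open>\<Sigma>\<close>-images of a well-order of its classes. Hence it maps this well-order
to the same relation as some \<open>\<sigma> \<in> \<Sigma>\<close>, and by rigidity it agrees with \<open>\<sigma>\<close> up to the congruence.\<close>

lemma Sim_Inv_subset:
  fixes \<Pi> \<Sigma> :: "('a \<times> 'a) set set"
  assumes inf: "infinite (UNIV :: 'v set)"
    and sims: "\<forall>\<pi>\<in>\<Sigma>. similarity \<pi>" and full: "full_monoid \<Sigma>" and sub: "\<Pi> \<subseteq> \<Sigma>"
  shows "Sim TYPE('v) (Inv \<Pi>) \<subseteq> \<Sigma>"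
proof
  fix \<pi> assume \<pi>: "\<pi> \<in> Sim TYPE('v) (Inv \<Pi>)"
  define E where "E = approx \<Sigma>"
  note equiv = equiv_approx[OF sims full, folded E_def]
  note comp = compatible_approx[OF sims full, folded E_def]
  have E_refl: "refl E" using equiv by (simp add: equiv_def)
  note compose = full_monoid_relcomp[OF full]
  note conv = full_monoid_converse[OF full]
  have "Rel 2 (pairs E) \<in> Inv \<Pi>"
    unfolding Rel_in_Inv_iff rel_inv_pairs_iff using comp sub pairs_tuples by blast
  then have \<pi>E: "compatible E \<pi>" and simE: "compatible E (simeq TYPE('v) (Inv \<Pi>))"
    using Sim_rel[OF \<pi>] Sim_rel[OF simeq_in_Sim[OF inf]] unfolding rel_inv_pairs_iff[symmetric] by blast+
  \<comment> \<open>Compatibility applied to the pairs \<open>(a, a)\<close> and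
    \<open>(a, b)\<close> of \<open>simeq\<close> gives this. Hence \<open>E\<close>-invariant
    relations fall within the scope of \<open>Q_inv\<close>.\<close>
  have sim_sub: "simeq TYPE('v) (Inv \<Pi>) \<subseteq> E"
    using simE E_refl simeq_refl unfolding compatible_def refl_on_def by fast
  obtain r where r: "wf r" "\<And>a b. (a, b) \<in> E \<or> (a, b) \<in> r \<or> (b, a) \<in> r"
    "\<And>a b a' b'. (a, a') \<in> E \<Longrightarrow> (b, b') \<in> E \<Longrightarrow> (a, b) \<in> r \<longleftrightarrow> (a', b') \<in> r"
    by (rule ex_wf_class_order[OF equiv]) (rule that)
  define R where "R = pairs r"
  have R2: "R \<subseteq> tuples 2" unfolding R_def by (rule pairs_tuples)
  have R_inv: "rel_inv E 2 R" unfolding R_def rel_inv_pairs_iff compatible_def using r(3) by blast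
  define Q where "Q = {[S] |S. S \<subseteq> tuples 2 \<and> (\<exists>\<sigma>\<in>\<Sigma>. sim_rel \<sigma> 2 R S)}"
  have "Quant [2] Q \<in> Inv \<Pi>"
    unfolding Quant_in_Inv_iff
  proof (intro conjI ballI quant_invI)
    show "Q \<subseteq> rels_of_type [2]" by (auto simp: Q_def rels_of_type_def)
  next
    fix \<rho> Rs Ss assume \<rho>: "\<rho> \<in> \<Pi>" and *: "Rs \<in> rels_of_type [2]" "Ss \<in> rels_of_type [2]"
      "\<forall>i<length [2]. sim_rel \<rho> ([2] ! i) (Rs ! i) (Ss ! i)"
    obtain T U where TU: "Rs = [T]" "Ss = [U]" "T \<subseteq> tuples 2" "U \<subseteq> tuples 2" "sim_rel \<rho> 2 T U"
      using * by (auto simp: rels_of_type_def length_Suc_conv)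
    have "\<rho> \<in> \<Sigma>" using \<rho> sub by blast
    \<comment> \<open>A witness for \<open>T\<close> is composed with \<open>\<rho>\<close>, a
      witness for \<open>U\<close> with its converse.\<close>
    then have "(\<exists>\<sigma>\<in>\<Sigma>. sim_rel \<sigma> 2 R T) \<longleftrightarrow> (\<exists>\<sigma>\<in>\<Sigma>. sim_rel \<sigma> 2 R U)"
      using TU(5) sim_rel_converse[of \<rho>] sim_rel_relcompI compose conv by metis
    then show "Rs \<in> Q \<longleftrightarrow> Ss \<in> Q" using TU by (simp add: Q_def)
  qed
  note Q_inv = Sim_quant[OF \<pi> this]
  let ?S = "image_rel \<pi> R"
  have RS: "sim_rel \<pi> 2 R ?S" by (rule sim_rel_image_rel[OF \<pi>E E_refl R_inv])
  have S_inv: "rel_inv E 2 ?S" by (rule rel_inv_sim_rel[OF \<pi>E Sim_similarity[OF \<pi>] R_inv RS])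
  have S2: "?S \<subseteq> tuples 2" by (rule image_rel_tuples[OF R2])
  have "[R] \<in> Q"
    using full_monoid_Id[OF sims full] R2 by (auto simp: Q_def sim_rel_def tup_rel_def list.rel_eq intro!: bexI[of _ Id])
  moreover have "[R] \<in> Q \<longleftrightarrow> [?S] \<in> Q"
    using R2 S2 RS rel_inv_antimono[OF sim_sub] R_inv S_inv
    by (intro quant_invD[OF Q_inv]) (simp_all add: rels_of_type_def)
  ultimately obtain \<sigma> where \<sigma>: "\<sigma> \<in> \<Sigma>" "sim_rel \<sigma> 2 R ?S" by (auto simp: Q_def)
  \<comment> \<open>Both factors link \<open>R\<close> with the same \<open>?S\<close>, so
    \<open>?\<tau>\<close> preserves the order and rigidity applies.\<close>
  let ?\<tau> = "\<pi> O \<sigma>\<inverse>"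
  have "sim_rel ?\<tau> 2 R R" using RS \<sigma>(2) sim_rel_converse sim_rel_relcompI by blast
  then have \<tau>: "compatible r ?\<tau>" unfolding R_def rel_inv_def[symmetric] rel_inv_pairs_iff .
  have \<tau>_sim: "similarity ?\<tau>" using \<sigma>(1) sims by (intro similarity_relcomp similarity_converse Sim_similarity[OF \<pi>]) blast
  have "\<pi> \<subseteq> E O \<sigma>"
  proof
    fix p assume "p \<in> \<pi>"
    then obtain a c where p: "p = (a, c)" "(a, c) \<in> \<pi>" by (cases p) blast
    obtain b where b: "(b, c) \<in> \<sigma>" using similarity_left[OF sims[rule_format, OF \<sigma>(1)]] by blast
    then have ab: "(a, b) \<in> ?\<tau>" using p(2) by blast
    have "(a, b) \<in> E" by (rule wf_order_rigid[OF equiv r(1,2) _ \<tau>_sim \<tau> ab]) (rule r(3))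
    then show "p \<in> E O \<sigma>" unfolding p(1) using b by blast
  qed
  moreover have "E O \<sigma> \<in> \<Sigma>"
    using full unfolding E_def by (intro compose \<sigma>(1)) (simp add: full_monoid_def)
  ultimately show "\<pi> \<in> \<Sigma>"
    using full_monoid_subset[OF full] Sim_similarity[OF \<pi>] by blast
qed

theorem theorem10:
  fixes q :: "'a oper set" and \<Pi> :: "('a \<times> 'a) set set" and vt :: "'v itself"
  assumes vars: "\<exists>f :: ('a + nat) \<Rightarrow> 'v. inj f"
    and wf: "\<forall>op\<in>q. wf_oper op"
    and sims: "\<forall>\<pi>\<in>\<Pi>. similarity \<pi>"
  shows "(\<forall>ks Q. Q \<subseteq> rels_of_type ks \<longrightarrow>
            (Quant ks Q \<in> Inv (Sim TYPE('v) q) \<longleftrightarrow>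
             definable_quant TYPE('v) q ks (restrict_quant TYPE('v) q ks Q)))
       \<and> (\<forall>k R. R \<subseteq> tuples k \<longrightarrow>
            (Rel k R \<in> Inv (Sim TYPE('v) q) \<longleftrightarrow> definable_rel TYPE('v) q k R))
       \<and> (full_monoid (Sim TYPE('v) (Inv \<Pi>)) \<and> \<Pi> \<subseteq> Sim TYPE('v) (Inv \<Pi>) \<and>
          (\<forall>\<Sigma>. (\<forall>\<pi>\<in>\<Sigma>. similarity \<pi>) \<and> full_monoid \<Sigma> \<and> \<Pi> \<subseteq> \<Sigma> \<longrightarrow>
                Sim TYPE('v) (Inv \<Pi>) \<subseteq> \<Sigma>))"
proof -
  obtain f :: "'a + nat \<Rightarrow> 'v" where f: "inj f" using vars by blast
  \<comment> \<open>The two summands supply the variables naming elements and the argument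
    variables.\<close>
  have y: "inj (f \<circ> Inl)" and z: "inj (f \<circ> Inr)" and yz: "(f \<circ> Inl) b \<noteq> (f \<circ> Inr) n" for b n
    using f by (simp_all add: inj_compose inj_eq)
  note inf = infinite_vars[OF y z yz]
  show ?thesis
  proof (intro conjI allI impI)
    show "Quant ks Q \<in> Inv (Sim TYPE('v) q) \<longleftrightarrow>
        definable_quant TYPE('v) q ks (restrict_quant TYPE('v) q ks Q)"
      if Q: "Q \<subseteq> rels_of_type ks" for ks Q
      unfolding Quant_in_Inv_iff approx_Sim[OF inf]
      using Q definable_quantI[OF y z yz Q] definable_quantD[OF y z yz Q] by blast
    show "Rel k R \<in> Inv (Sim TYPE('v) q) \<longleftrightarrow> definable_rel TYPE('v) q k R"
      if R: "R \<subseteq> tuples k" for k R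
      unfolding Rel_in_Inv_iff using R definable_relI[OF y z yz R] definable_relD[OF y z yz] by blast
    show "full_monoid (Sim TYPE('v) (Inv \<Pi>))" by (rule full_monoid_Sim[OF inf])
    show "\<Pi> \<subseteq> Sim TYPE('v) (Inv \<Pi>)" by (rule subset_Sim_Inv[OF sims])
    show "Sim TYPE('v) (Inv \<Pi>) \<subseteq> \<Sigma>"
      if "(\<forall>\<pi>\<in>\<Sigma>. similarity \<pi>) \<and> full_monoid \<Sigma> \<and> \<Pi> \<subseteq> \<Sigma>" for \<Sigma>
      using that by (intro Sim_Inv_subset[OF inf]) auto
  qed
qed

end
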